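(* Let $Z$ be a Banach space and $m\in \mathbb N$, $m\ge 1$. If $$\mathcal L(^{m+1}\ell_1,\ldots,\ell_1,Z;\mathbb K)=\Pi_{1,1}^{mult} (^{m+1}\ell_1,\ldots,\ell_1, Z;\mathbb K)$$ (with $m$ copies of $\ell_1$), then $q_Z= 2$.
   Context: Scalars are $\mathbb K=\mathbb R$ or $\mathbb C$. $q_Z=\inf\{2\leq q\leq\infty:\ Z\text{ has cotype }q\}$. $\mathcal L(^NX_1,\dots,X_N;Y)$ is the space of continuous $N$-linear maps $X_1\times\cdots\times X_N\to Y$. For a sequence $x=(x_i)$ in a Banach space $X$, $\omega_p(x)=\sup_{\|x^*\|\leq 1}\big(\sum_i |x^*(x_i)|^p\big)^{1/p}$. An $N$-linear map $T:X_1\times\cdots\times X_N\to Y$ is multiple $(r,p)$-summing if there is $C>0$ such that for all sequences $x(j)=(x_i(j))_i\subset X_j$, $$\Big(\sum_{i_1,\dots,i_N\in\mathbb N}\|T(x_{i_1}(1),\dots,x_{i_N}(N))\|^r\Big)^{1/r}\leq C\,\omega_p(x(1))\cdots\omega_p(x(N)).$$ $\Pi^{mult}_{r,p}(^NX_1,\dots,X_N;Y)$ is the class of all such (continuous) maps. *)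

theory Defs
  imports "HOL-Analysis.Analysis"
begin

section \<open>Normed spaces over \<open>\<real>\<close> or \<open>\<complex>\<close>\<close>

text \<open>
  The library classes \<^class>\<open>real_normed_vector\<close> and \<^class>\<open>banach\<close> are real. A (Banach) space over
  a larger scalar field is a (Banach) space of these classes together with a scalar multiplication
  that extends the real one and for which the norm is absolutely homogeneous.
  Only the scalar fields \<^typ>\<open>real\<close> and \<^typ>\<open>complex\<close> are used.
\<close>

locale normed_space_over = vector_space scale
  for scale :: "'k::real_normed_field \<Rightarrow> 'a::real_normed_vector \<Rightarrow> 'a" +
  assumes norm_scale: "norm (scale c x) = norm c * norm x"
    and scale_of_real: "scale (of_real t) x = t *\<^sub>R x"

lemma normed_space_over_scaleR: "normed_space_over (scaleR :: real \<Rightarrow> 'a::real_normed_vector \<Rightarrow> 'a)"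
  by unfold_locales (auto simp: scaleR_add_right scaleR_add_left)

lemma normed_space_over_mult: "normed_space_over ((*) :: 'k::real_normed_field \<Rightarrow> 'k \<Rightarrow> 'k)"
  by unfold_locales (auto simp: algebra_simps norm_mult scaleR_conv_of_real)


section \<open>The sequence space \<open>\<ell>\<^sub>1\<close>\<close>

typedef (overloaded) ('k::real_normed_vector) ell1 =
  "{a :: nat \<Rightarrow> 'k. summable (\<lambda>n. norm (a n))}"
  morphisms ell1_nth Abs_ell1
  by (rule exI[of _ "\<lambda>_. 0"]) simp

setup_lifting type_definition_ell1

lemma summable_ell1: "summable (\<lambda>n. norm (ell1_nth a n))"
  using ell1_nth[of a] by simp

lemma summable_norm_add:
  fixes a b :: "nat \<Rightarrow> 'k::real_normed_vector"
  assumes "summable (\<lambda>n. norm (a n))" "summable (\<lambda>n. norm (b n))"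
  shows "summable (\<lambda>n. norm (a n + b n))"
  by (rule summable_comparison_test'[OF summable_add[OF assms], of 0])
     (simp add: norm_triangle_ineq)

instantiation ell1 :: (real_normed_vector) real_normed_vector
begin

lift_definition zero_ell1 :: "'a ell1" is "\<lambda>_. 0" by simp

lift_definition plus_ell1 :: "'a ell1 \<Rightarrow> 'a ell1 \<Rightarrow> 'a ell1" is "\<lambda>a b n. a n + b n"
  by (rule summable_norm_add)

lift_definition uminus_ell1 :: "'a ell1 \<Rightarrow> 'a ell1" is "\<lambda>a n. - a n" by simp

lift_definition minus_ell1 :: "'a ell1 \<Rightarrow> 'a ell1 \<Rightarrow> 'a ell1" is "\<lambda>a b n. a n - b n"
  subgoal for a b using summable_norm_add[of a "\<lambda>n. - b n"] by simp
  done

lift_definition scaleR_ell1 :: "real \<Rightarrow> 'a ell1 \<Rightarrow> 'a ell1" is "\<lambda>t a n. t *\<^sub>R a n"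
  by (simp add: summable_mult)

lift_definition norm_ell1 :: "'a ell1 \<Rightarrow> real" is "\<lambda>a. \<Sum>n. norm (a n)" .

definition "sgn_ell1 (a :: 'a ell1) = scaleR (inverse (norm a)) a"
definition "dist_ell1 (a :: 'a ell1) b = norm (a - b)"
definition [code del]:
  "(uniformity :: ('a ell1 \<times> 'a ell1) filter) = (INF e\<in>{0 <..}. principal {(x, y). dist x y < e})"
definition [code del]:
  "open (U :: 'a ell1 set) \<longleftrightarrow> (\<forall>x\<in>U. \<forall>\<^sub>F (x', y) in uniformity. x' = x \<longrightarrow> y \<in> U)"

instance
proof
  fix a b c :: "'a ell1" and s t :: real and U :: "'a ell1 set"
  show "a + b + c = a + (b + c)" by transfer (simp add: add.assoc)
  show "a + b = b + a" by transfer (simp add: add.commute)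
  show "0 + a = a" by transfer simp
  show "- a + a = 0" by transfer simp
  show "a - b = a + - b" by transfer simp
  show "s *\<^sub>R (a + b) = s *\<^sub>R a + s *\<^sub>R b" by transfer (simp add: scaleR_add_right)
  show "(s + t) *\<^sub>R a = s *\<^sub>R a + t *\<^sub>R a" by transfer (simp add: scaleR_add_left)
  show "s *\<^sub>R t *\<^sub>R a = (s * t) *\<^sub>R a" by transfer simp
  show "1 *\<^sub>R a = a" by transfer simp
  show "sgn a = inverse (norm a) *\<^sub>R a" by (simp add: sgn_ell1_def)
  show "dist a b = norm (a - b)" by (simp add: dist_ell1_def)
  show "(norm a = 0) = (a = 0)"
    by transfer (auto simp: suminf_eq_zero_iff fun_eq_iff)
  show "norm (a + b) \<le> norm a + norm b"
  proof transfer
    fix a b :: "nat \<Rightarrow> 'a"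
    assume *: "summable (\<lambda>n. norm (a n))" "summable (\<lambda>n. norm (b n))"
    have "(\<Sum>n. norm (a n + b n)) \<le> (\<Sum>n. norm (a n) + norm (b n))"
      by (intro suminf_le norm_triangle_ineq summable_norm_add summable_add *)
    then show "(\<Sum>n. norm (a n + b n)) \<le> (\<Sum>n. norm (a n)) + (\<Sum>n. norm (b n))"
      by (simp add: suminf_add *)
  qed
  show "norm (s *\<^sub>R a) = \<bar>s\<bar> * norm a"
    by transfer (simp add: suminf_mult)
  show "(uniformity :: ('a ell1 \<times> 'a ell1) filter) = (INF e\<in>{0 <..}. principal {(x, y). dist x y < e})"
    by (rule uniformity_ell1_def)
  show "open U \<longleftrightarrow> (\<forall>x\<in>U. \<forall>\<^sub>F (x', y) in uniformity. x' = x \<longrightarrow> y \<in> U)"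
    by (rule open_ell1_def)
qed

end

lift_definition scale_ell1 :: "'k::real_normed_field \<Rightarrow> 'k ell1 \<Rightarrow> 'k ell1"
  is "\<lambda>c a n. c * a n"
  by (simp add: norm_mult summable_mult)

lemma normed_space_over_scale_ell1: "normed_space_over scale_ell1"
  by unfold_locales
     (transfer; simp add: algebra_simps norm_mult suminf_mult scaleR_conv_of_real)+


section \<open>Cotype\<close>

text \<open>
  The \<open>L\<^sub>2\<close>-norm of the Rademacher sum \<open>\<Sum>i<n. r\<^sub>i x\<^sub>i\<close>, as the average over all choices of signs.
\<close>

definition rademacher_avg :: "nat \<Rightarrow> (nat \<Rightarrow> 'z::real_normed_vector) \<Rightarrow> real" where
  "rademacher_avg n x =
     sqrt ((\<Sum>\<epsilon>\<in>{..<n} \<rightarrow>\<^sub>E {-1, 1}. (norm (\<Sum>i<n. \<epsilon> i *\<^sub>R x i))\<^sup>2) / 2 ^ n)"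

text \<open>For \<open>q = \<infinity>\<close> the \<open>\<ell>\<^sub>q\<close>-norm is the maximum; every normed space has cotype \<open>\<infinity>\<close>.\<close>

definition has_cotype :: "'z::real_normed_vector itself \<Rightarrow> ereal \<Rightarrow> bool" where
  "has_cotype _ q \<longleftrightarrow> (\<exists>C>0. \<forall>n (x :: nat \<Rightarrow> 'z).
     (if q = \<infinity> then \<forall>i<n. norm (x i) \<le> C * rademacher_avg n x
      else (\<Sum>i<n. norm (x i) powr real_of_ereal q) powr (1 / real_of_ereal q)
             \<le> C * rademacher_avg n x))"

definition cotype_index :: "'z::real_normed_vector itself \<Rightarrow> ereal" where
  "cotype_index Z = Inf {q. 2 \<le> q \<and> has_cotype Z q}"


section \<open>Multiple summing maps\<close>

text \<open>Powers with exponent \<open>s > 0\<close>.\<close>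

definition enn_powr :: "ennreal \<Rightarrow> real \<Rightarrow> ennreal" where
  "enn_powr a s = (if a = top then top else ennreal (enn2real a powr s))"

definition dual_ball :: "('k::real_normed_field \<Rightarrow> 'a::real_normed_vector \<Rightarrow> 'a) \<Rightarrow> ('a \<Rightarrow> 'k) set" where
  "dual_ball sX = {f. Vector_Spaces.linear sX (*) f \<and> bounded_linear f \<and> onorm f \<le> 1}"

text \<open>The weak \<open>\<ell>\<^sub>p\<close>-norm \<open>\<omega>\<^sub>p\<close>; it may be infinite.\<close>

definition weak_norm ::
  "('k::real_normed_field \<Rightarrow> 'a::real_normed_vector \<Rightarrow> 'a) \<Rightarrow> real \<Rightarrow> (nat \<Rightarrow> 'a) \<Rightarrow> ennreal" where
  "weak_norm sX p x =
     (SUP f\<in>dual_ball sX. enn_powr (\<Sum>i. ennreal (norm (f (x i)) powr p)) (1 / p))"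

text \<open>
  Maps on \<open>X\<^sub>1 \<times> \<dots> \<times> X\<^sub>N\<close> with \<open>N = m + 1\<close>, where \<open>X\<^sub>1 = \<dots> = X\<^sub>m\<close> is the space \<^typ>\<open>'e\<close>
  and \<open>X\<^sub>N\<close> is the space \<^typ>\<open>'f\<close>: the first \<open>m\<close> arguments are a function on a finite index
  type \<^typ>\<open>'m\<close> with \<open>m\<close> elements, so that \<open>m\<close> is an arbitrary integer \<open>\<ge> 1\<close>. The topology on \<^typ>\<open>'m \<Rightarrow> 'e\<close> is the product topology.
\<close>

definition multilinear_maps ::
  "('k::real_normed_field \<Rightarrow> 'e::real_normed_vector \<Rightarrow> 'e) \<Rightarrow>
   ('k \<Rightarrow> 'f::real_normed_vector \<Rightarrow> 'f) \<Rightarrow> ('k \<Rightarrow> 'y::real_normed_vector \<Rightarrow> 'y) \<Rightarrow>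
   (('m::finite \<Rightarrow> 'e) \<times> 'f \<Rightarrow> 'y) set" where
  "multilinear_maps sE sF sY = {T.
     (\<forall>k x z. Vector_Spaces.linear sE sY (\<lambda>u. T (x(k := u), z))) \<and>
     (\<forall>x. Vector_Spaces.linear sF sY (\<lambda>z. T (x, z))) \<and>
     continuous_on UNIV T}"

text \<open>
  In the product of weak norms \<open>0 * \<infinity> = 0\<close>. This is harmless: a sequence with weak norm \<open>0\<close>
  vanishes, and then so does the left-hand side.
\<close>

definition mult_summing_maps ::
  "real \<Rightarrow> real \<Rightarrow> ('k::real_normed_field \<Rightarrow> 'e::real_normed_vector \<Rightarrow> 'e) \<Rightarrow>
   ('k \<Rightarrow> 'f::real_normed_vector \<Rightarrow> 'f) \<Rightarrow> ('k \<Rightarrow> 'y::real_normed_vector \<Rightarrow> 'y) \<Rightarrow>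
   (('m::finite \<Rightarrow> 'e) \<times> 'f \<Rightarrow> 'y) set" where
  "mult_summing_maps r p sE sF sY = {T \<in> multilinear_maps sE sF sY.
     \<exists>C>0. \<forall>(x :: 'm \<Rightarrow> nat \<Rightarrow> 'e) (z :: nat \<Rightarrow> 'f).
       enn_powr (\<Sum>\<^sub>\<infinity>(i, j)\<in>(UNIV :: (('m \<Rightarrow> nat) \<times> nat) set).
                   ennreal (norm (T (\<lambda>k. x k (i k), z j)) powr r)) (1 / r)
         \<le> ennreal C * (\<Prod>k\<in>UNIV. weak_norm sE p (x k)) * weak_norm sF p z}"

end

theory Submission
  imports Defs "HOL-Library.Ramsey"
begin

text \<open>
  If \<open>(\<phi>\<^sub>p)\<close> are functionals on \<open>Z\<close> of norm at most 1, then \<open>(a, z) \<mapsto> \<Sum>p. a\<^sub>p \<phi>\<^sub>p(z)\<close> is a bounded bilinear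
  form on \<open>\<ell>\<^sub>1 \<times> Z\<close>. Testing its summability on the \<open>2\<^sup>n\<close> vectors \<open>2\<^sup>-\<^sup>n (c\<^sub>j \<epsilon>\<^sub>j)\<^sub>j\<close>, whose weak norm is at most
  the Euclidean norm of \<open>c\<close>, against vectors \<open>z\<^sub>j\<close> normed by \<open>\<phi>\<^sub>j\<close> shows that \<open>\<Sum>j. \<parallel>z\<^sub>j\<parallel>\<^sup>2\<close> is controlled
  by the square of the largest \<open>\<parallel>\<Sum>j. \<plusminus>z\<^sub>j\<parallel>\<close> (the Orlicz property). A single form serves
  all finite families at once, so the constant is uniform.

  The Orlicz property yields cotype \<open>q\<close> for every \<open>q > 2\<close>. Let \<open>F n\<close> be the square of the best
  cotype 2 constant for \<open>n\<close> vectors. If \<open>F\<close> is not \<open>O(n\<^sup>2\<^sup>a)\<close>, then for every \<open>k\<close> there are arbitrarily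
  large \<open>F (k P) > k\<^sup>2\<^sup>a F P\<close>. From a nearly extremal family of \<open>k P\<close> vectors one discards a maximal
  disjoint collection of \<open>k\<close>-subsets with large Rademacher average; at most half of the weight is
  lost, so there remain many vectors of comparable norm, any \<open>k\<close> of which have a Rademacher average
  of order \<open>k\<^bsup>1/2 - a\<^esup>\<close>. By Ramsey's theorem one sign pattern makes the signed sum of all \<open>k\<close>-subsets
  of a subfamily small. Subtracting two interlaced such sums gives every signed sum of \<open>k\<close>
  separated differences, which contradicts the Orlicz property for large \<open>k\<close>.
\<close>

section \<open>Rademacher averages\<close>

abbreviation signs :: "nat \<Rightarrow> (nat \<Rightarrow> real) set" where
  "signs m \<equiv> {..<m} \<rightarrow>\<^sub>E {-1, 1}"

definition rad2 :: "nat \<Rightarrow> (nat \<Rightarrow> 'z::real_normed_vector) \<Rightarrow> real" where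
  "rad2 m x = (\<Sum>\<epsilon>\<in>signs m. (norm (\<Sum>i<m. \<epsilon> i *\<^sub>R x i))\<^sup>2) / 2 ^ m"

text \<open>Subfamilies keep the full index range and are padded with zeros, so that all their
  averages run over the same sign cube \<open>signs m\<close>.\<close>

definition zero_outside :: "'i set \<Rightarrow> ('i \<Rightarrow> 'z::zero) \<Rightarrow> 'i \<Rightarrow> 'z" where
  "zero_outside A x i = (if i \<in> A then x i else 0)"

lemma finite_signs: "finite (signs m)"
  by (intro finite_PiE) auto

lemma card_signs: "card (signs m) = 2 ^ m"
  by (simp add: card_PiE card_insert_if numeral_2_eq_2)

lemma signs_nonempty: "signs m \<noteq> {}"
  by (simp add: PiE_eq_empty_iff)

lemma signs_mem: "\<epsilon> \<in> signs m \<Longrightarrow> i < m \<Longrightarrow> \<epsilon> i \<in> {-1, 1}"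
  by (drule PiE_mem[where x = i]) auto

lemma sum_scaleR_zero_outside:
  fixes x :: "nat \<Rightarrow> 'z::real_normed_vector"
  assumes "A \<subseteq> {..<m}"
  shows "(\<Sum>i<m. c i *\<^sub>R zero_outside A x i) = (\<Sum>i\<in>A. c i *\<^sub>R x i)"
proof -
  have "(\<Sum>i<m. c i *\<^sub>R zero_outside A x i) = (\<Sum>i<m. if i \<in> A then c i *\<^sub>R x i else 0)"
    by (intro sum.cong) (auto simp: zero_outside_def)
  also have "\<dots> = (\<Sum>i\<in>A. c i *\<^sub>R x i)"
    using assms by (simp add: sum.If_cases Int_absorb1)
  finally show ?thesis .
qed

lemma rademacher_avg_rad2: "rademacher_avg n x = sqrt (rad2 n x)"
  by (simp add: rademacher_avg_def rad2_def)

lemma rad2_nonneg: "0 \<le> rad2 m x"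
  by (simp add: rad2_def sum_nonneg)

lemma rad2_cong: "(\<And>i. i < m \<Longrightarrow> x i = y i) \<Longrightarrow> rad2 m x = rad2 m y"
  by (simp add: rad2_def)

lemma rad2_scale: "rad2 m (\<lambda>i. c *\<^sub>R x i) = c\<^sup>2 * rad2 m x"
proof -
  have "(\<Sum>i<m. e i *\<^sub>R c *\<^sub>R x i) = c *\<^sub>R (\<Sum>i<m. e i *\<^sub>R x i)" for e :: "nat \<Rightarrow> real"
    by (simp add: scaleR_sum_right mult.commute)
  then show ?thesis
    by (simp add: rad2_def power_mult_distrib sum_distrib_left)
qed

text \<open>Coordinatewise multiplication by \<open>s\<close> is an involution of the sign cube. A
  general \<open>g\<close> covers norms as well as squared norms.\<close>

lemma sum_signs_flip:
  fixes x :: "nat \<Rightarrow> 'z::real_normed_vector"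
  assumes s: "\<And>i. i < m \<Longrightarrow> s i \<in> {-1, 1::real}"
  shows "(\<Sum>\<epsilon>\<in>signs m. g (\<Sum>i<m. \<epsilon> i *\<^sub>R s i *\<^sub>R x i)) = (\<Sum>\<epsilon>\<in>signs m. g (\<Sum>i<m. \<epsilon> i *\<^sub>R x i))"
proof -
  define \<phi> where "\<phi> \<epsilon> = (\<lambda>i\<in>{..<m}. \<epsilon> i * s i)" for \<epsilon> :: "nat \<Rightarrow> real"
  have ss: "s i * s i = 1" if "i < m" for i
    using s[OF that] by auto
  have maps: "\<phi> \<epsilon> \<in> signs m" if "\<epsilon> \<in> signs m" for \<epsilon>
    unfolding \<phi>_def
  proof (rule restrict_PiE_iff[THEN iffD2], rule ballI)
    fix i assume "i \<in> {..<m}"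
    then show "\<epsilon> i * s i \<in> {-1, 1}"
      using signs_mem[OF that, of i] s[of i] by auto
  qed
  have inv: "\<phi> (\<phi> \<epsilon>) = \<epsilon>" if "\<epsilon> \<in> signs m" for \<epsilon>
  proof
    fix i
    show "\<phi> (\<phi> \<epsilon>) i = \<epsilon> i"
      using ss[of i] PiE_arb[OF that, of i] by (simp add: \<phi>_def mult.assoc)
  qed
  have bij: "bij_betw \<phi> (signs m) (signs m)"
    by (rule bij_betw_byWitness[where f' = \<phi>]) (use maps inv in auto)
  have "(\<Sum>\<epsilon>\<in>signs m. g (\<Sum>i<m. \<epsilon> i *\<^sub>R x i))
      = (\<Sum>\<epsilon>\<in>signs m. g (\<Sum>i<m. \<phi> \<epsilon> i *\<^sub>R x i))"
    by (rule sum.reindex_bij_betw[OF bij, symmetric])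
  then show ?thesis
    by (simp add: \<phi>_def)
qed

lemma rad2_flip:
  assumes "\<And>i. i < m \<Longrightarrow> s i \<in> {-1, 1::real}"
  shows "rad2 m (\<lambda>i. s i *\<^sub>R x i) = rad2 m x"
  using sum_signs_flip[OF assms, where g = "\<lambda>v. (norm v)\<^sup>2"] by (simp add: rad2_def)

lemma norm_avg_power2_le:
  fixes u v :: "'z::real_normed_vector"
  shows "(norm ((1/2) *\<^sub>R (u + v)))\<^sup>2 \<le> ((norm u)\<^sup>2 + (norm v)\<^sup>2) / 2"
proof -
  have "(norm (u + v))\<^sup>2 \<le> (norm u + norm v)\<^sup>2"
    by (simp add: norm_triangle_ineq power_mono)
  also have "\<dots> \<le> 2 * ((norm u)\<^sup>2 + (norm v)\<^sup>2)"
    using sum_squares_ge_zero[of "norm u - norm v" 0] by (simp add: power2_eq_square algebra_simps)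
  finally show ?thesis
    by (simp add: power_divide)
qed

text \<open>The padded family is the midpoint of \<open>x\<close> and of \<open>x\<close> with its
  signs reversed off \<open>A\<close>. Both have the same average by \<open>rad2_flip\<close>, and
  the squared norm is convex.\<close>

lemma rad2_zero_outside_le:
  assumes "A \<subseteq> {..<m}"
  shows "rad2 m (zero_outside A x) \<le> rad2 m x"
proof -
  define s :: "nat \<Rightarrow> real" where "s i = (if i \<in> A then 1 else -1)" for i
  define y where "y i = s i *\<^sub>R x i" for i
  have "(norm (\<Sum>i<m. \<epsilon> i *\<^sub>R zero_outside A x i))\<^sup>2
      \<le> ((norm (\<Sum>i<m. \<epsilon> i *\<^sub>R x i))\<^sup>2 + (norm (\<Sum>i<m. \<epsilon> i *\<^sub>R y i))\<^sup>2) / 2" for \<epsilon>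
  proof -
    have "zero_outside A x i = (1/2) *\<^sub>R (x i + y i)" for i
      by (simp add: zero_outside_def y_def s_def scaleR_half_double)
    then have "(\<Sum>i<m. \<epsilon> i *\<^sub>R zero_outside A x i)
        = (1/2) *\<^sub>R ((\<Sum>i<m. \<epsilon> i *\<^sub>R x i) + (\<Sum>i<m. \<epsilon> i *\<^sub>R y i))"
      by (simp add: sum.distrib scaleR_sum_right scaleR_add_right)
    then show ?thesis
      by (simp only: norm_avg_power2_le)
  qed
  then have "rad2 m (zero_outside A x) \<le> (\<Sum>\<epsilon>\<in>signs m. ((norm (\<Sum>i<m. \<epsilon> i *\<^sub>R x i))\<^sup>2
      + (norm (\<Sum>i<m. \<epsilon> i *\<^sub>R y i))\<^sup>2) / 2) / 2 ^ m"
    unfolding rad2_def by (intro divide_right_mono sum_mono) auto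
  also have "\<dots> = (rad2 m x + rad2 m y) / 2"
    by (simp add: rad2_def sum.distrib sum_divide_distrib[symmetric] add_divide_distrib)
  also have "rad2 m y = rad2 m x"
    unfolding y_def by (rule rad2_flip) (simp add: s_def)
  finally show ?thesis by simp
qed

lemma rad2_single:
  assumes "j < m"
  shows "rad2 m (zero_outside {j} x) = (norm (x j))\<^sup>2"
proof -
  have "(norm (\<Sum>i<m. \<epsilon> i *\<^sub>R zero_outside {j} x i))\<^sup>2 = (norm (x j))\<^sup>2" if "\<epsilon> \<in> signs m" for \<epsilon>
  proof -
    have "\<epsilon> j \<in> {-1, 1}"
      using signs_mem[OF that assms] .
    then have "norm (\<epsilon> j *\<^sub>R x j) = norm (x j)" by auto
    then show ?thesis
      using assms by (simp add: sum_scaleR_zero_outside)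
  qed
  then show ?thesis
    by (simp add: rad2_def card_signs)
qed

lemma norm_le_rad2: "j < m \<Longrightarrow> (norm (x j))\<^sup>2 \<le> rad2 m x"
  using rad2_zero_outside_le[of "{j}" m x] by (simp add: rad2_single)

text \<open>Vectors are added one at a time: averaging over the sign of the new vector, the
  parallelogram law splits off its squared norm.\<close>

lemma rad2_inner:
  fixes x :: "nat \<Rightarrow> 'z::real_inner"
  shows "rad2 m x = (\<Sum>i<m. (norm (x i))\<^sup>2)"
proof -
  have "rad2 m (zero_outside A x) = (\<Sum>i\<in>A. (norm (x i))\<^sup>2)" if "finite A" "A \<subseteq> {..<m}" for A
    using that
  proof (induction A rule: finite_induct)
    case empty
    then show ?case by (simp add: rad2_def zero_outside_def)
  next
    case (insert j A)
    define u where "u \<epsilon> = (\<Sum>i\<in>A. \<epsilon> i *\<^sub>R x i)" for \<epsilon> :: "nat \<Rightarrow> real"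
    define s :: "nat \<Rightarrow> real" where "s i = (if i = j then -1 else 1)" for i
    have 1: "(\<Sum>i<m. \<epsilon> i *\<^sub>R zero_outside (insert j A) x i) = u \<epsilon> + \<epsilon> j *\<^sub>R x j" for \<epsilon>
      using insert by (simp add: sum_scaleR_zero_outside u_def add.commute)
    have 2: "(\<Sum>i<m. \<epsilon> i *\<^sub>R s i *\<^sub>R zero_outside (insert j A) x i) = u \<epsilon> - \<epsilon> j *\<^sub>R x j" for \<epsilon>
    proof -
      have "(\<Sum>i<m. \<epsilon> i *\<^sub>R s i *\<^sub>R zero_outside (insert j A) x i) = (\<Sum>i\<in>insert j A. (\<epsilon> i * s i) *\<^sub>R x i)"
        using sum_scaleR_zero_outside[of "insert j A" m "\<lambda>i. \<epsilon> i * s i" x] insert by simp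
      also have "\<dots> = u \<epsilon> - \<epsilon> j *\<^sub>R x j"
        using insert by (auto simp: u_def s_def intro!: sum.cong)
      finally show ?thesis .
    qed
    have "2 * rad2 m (zero_outside (insert j A) x)
        = rad2 m (zero_outside (insert j A) x) + rad2 m (\<lambda>i. s i *\<^sub>R zero_outside (insert j A) x i)"
      by (subst rad2_flip) (auto simp: s_def)
    also have "\<dots> = (\<Sum>\<epsilon>\<in>signs m. (norm (u \<epsilon> + \<epsilon> j *\<^sub>R x j))\<^sup>2 + (norm (u \<epsilon> - \<epsilon> j *\<^sub>R x j))\<^sup>2) / 2 ^ m"
      unfolding rad2_def 1 2 by (simp add: sum.distrib add_divide_distrib)
    also have "\<dots> = (\<Sum>\<epsilon>\<in>signs m. 2 * (norm (u \<epsilon>))\<^sup>2 + 2 * (norm (x j))\<^sup>2) / 2 ^ m"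
    proof (intro arg_cong2[where f = "(/)"] sum.cong refl)
      fix \<epsilon> assume "\<epsilon> \<in> signs m"
      then have "\<epsilon> j \<in> {-1, 1}" using insert by (intro signs_mem) auto
      then show "(norm (u \<epsilon> + \<epsilon> j *\<^sub>R x j))\<^sup>2 + (norm (u \<epsilon> - \<epsilon> j *\<^sub>R x j))\<^sup>2
          = 2 * (norm (u \<epsilon>))\<^sup>2 + 2 * (norm (x j))\<^sup>2"
        by (auto simp: power2_norm_eq_inner inner_simps inner_commute)
    qed
    also have "\<dots> = 2 * rad2 m (zero_outside A x) + 2 * (norm (x j))\<^sup>2"
      using insert.prems by (simp add: rad2_def sum_scaleR_zero_outside u_def sum.distrib card_signs
          add_divide_distrib flip: sum_distrib_left)
    finally show ?case using insert by simp
  qed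
  from this[of "{..<m}"] have "rad2 m (zero_outside {..<m} x) = (\<Sum>i<m. (norm (x i))\<^sup>2)"
    by simp
  moreover have "rad2 m (zero_outside {..<m} x) = rad2 m x"
    by (rule rad2_cong) (simp add: zero_outside_def)
  ultimately show ?thesis by simp
qed

section \<open>First moments, single sign choices and functionals against the average\<close>

lemma mean_norm_le_sqrt_rad2:
  "(\<Sum>\<epsilon>\<in>signs m. norm (\<Sum>i<m. \<epsilon> i *\<^sub>R x i)) / 2 ^ m \<le> sqrt (rad2 m x)"
proof (rule real_le_rsqrt)
  have "(\<Sum>\<epsilon>\<in>signs m. norm (\<Sum>i<m. \<epsilon> i *\<^sub>R x i))\<^sup>2 \<le> (2 ^ m * rad2 m x) * 2 ^ m"
    using sum_squared_le_sum_of_squares[of "\<lambda>\<epsilon>. norm (\<Sum>i<m. \<epsilon> i *\<^sub>R x i)" "signs m"]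
    by (simp add: rad2_def card_signs)
  then show "((\<Sum>\<epsilon>\<in>signs m. norm (\<Sum>i<m. \<epsilon> i *\<^sub>R x i)) / 2 ^ m)\<^sup>2 \<le> rad2 m x"
    by (simp add: power_divide power2_eq_square field_simps)
qed

text \<open>Reversing every sign except that of \<open>x j\<close> permutes the sign cube, and a
  signed sum plus its reversed partner is \<open>2 * \<epsilon> j\<close> times
  \<open>x j\<close>.\<close>

lemma norm_le_mean:
  assumes "j < m"
  shows "norm (x j) \<le> (\<Sum>\<epsilon>\<in>signs m. norm (\<Sum>i<m. \<epsilon> i *\<^sub>R x i)) / 2 ^ m"
proof -
  define s :: "nat \<Rightarrow> real" where "s i = (if i = j then 1 else -1)" for i
  have "2 * norm (x j) \<le> norm (\<Sum>i<m. \<epsilon> i *\<^sub>R x i) + norm (\<Sum>i<m. \<epsilon> i *\<^sub>R s i *\<^sub>R x i)"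
    if \<epsilon>: "\<epsilon> \<in> signs m" for \<epsilon>
  proof -
    have "(\<Sum>i<m. \<epsilon> i *\<^sub>R x i) + (\<Sum>i<m. \<epsilon> i *\<^sub>R s i *\<^sub>R x i) = (\<Sum>i<m. if i = j then (2 * \<epsilon> j) *\<^sub>R x j else 0)"
      unfolding sum.distrib[symmetric] by (intro sum.cong) (auto simp: s_def simp flip: scaleR_add_left)
    also have "\<dots> = (2 * \<epsilon> j) *\<^sub>R x j" using assms by simp
    also have "norm \<dots> = 2 * norm (x j)" using signs_mem[OF \<epsilon> assms] by auto
    finally show ?thesis by (metis norm_triangle_ineq)
  qed
  then have "(\<Sum>\<epsilon>\<in>signs m. 2 * norm (x j))
      \<le> (\<Sum>\<epsilon>\<in>signs m. norm (\<Sum>i<m. \<epsilon> i *\<^sub>R x i) + norm (\<Sum>i<m. \<epsilon> i *\<^sub>R s i *\<^sub>R x i))"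
    by (intro sum_mono)
  also have "\<dots> = 2 * (\<Sum>\<epsilon>\<in>signs m. norm (\<Sum>i<m. \<epsilon> i *\<^sub>R x i))"
    unfolding sum.distrib by (subst sum_signs_flip) (auto simp: s_def)
  finally show ?thesis by (simp add: card_signs field_simps)
qed

lemma rad2_attained:
  assumes "rad2 m x \<le> M\<^sup>2" "0 \<le> M"
  obtains \<epsilon> where "\<epsilon> \<in> signs m" "norm (\<Sum>i<m. \<epsilon> i *\<^sub>R x i) \<le> M"
proof -
  have "\<exists>\<epsilon>\<in>signs m. norm (\<Sum>i<m. \<epsilon> i *\<^sub>R x i) \<le> M"
  proof (rule ccontr)
    assume "\<not> ?thesis"
    then have *: "M < norm (\<Sum>i<m. \<epsilon> i *\<^sub>R x i)" if "\<epsilon> \<in> signs m" for \<epsilon>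
      using that not_le by blast
    have "(\<Sum>\<epsilon>\<in>signs m. M\<^sup>2) < (\<Sum>\<epsilon>\<in>signs m. (norm (\<Sum>i<m. \<epsilon> i *\<^sub>R x i))\<^sup>2)"
      by (intro sum_strict_mono finite_signs signs_nonempty power_strict_mono * assms(2)) auto
    then show False
      using assms(1) by (simp add: rad2_def card_signs field_simps)
  qed
  then show ?thesis using that by blast
qed

text \<open>For scalars the average is exactly the sum of squares (\<open>rad2_inner\<close>), and a
  linear contraction does not increase averages. This bounds averages in \<open>'z\<close> from
  below.\<close>

lemma rad2_linear_le:
  fixes f :: "'z::real_normed_vector \<Rightarrow> real"
  assumes lin: "linear f" and le: "\<And>z. \<bar>f z\<bar> \<le> norm z"
  shows "(\<Sum>i<m. (f (x i))\<^sup>2) \<le> rad2 m x"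
proof -
  have "(\<Sum>i<m. (f (x i))\<^sup>2) = rad2 m (\<lambda>i. f (x i))"
    by (simp add: rad2_inner)
  also have "\<dots> = (\<Sum>\<epsilon>\<in>signs m. (norm (f (\<Sum>i<m. \<epsilon> i *\<^sub>R x i)))\<^sup>2) / 2 ^ m"
    by (simp add: rad2_def linear_sum[OF lin] linear_scale[OF lin])
  also have "\<dots> \<le> rad2 m x"
    unfolding rad2_def by (intro divide_right_mono sum_mono power_mono) (auto simp: le)
  finally show ?thesis .
qed

text \<open>
  For fixed \<open>\<delta>\<close>, replacing \<open>\<epsilon> i\<close> by \<open>\<delta> (l i) * \<epsilon> i\<close> permutes the sign vectors, so an average over
  the signs of single vectors may be refined by independent signs of blocks.
\<close>

lemma rad2_blocks:
  fixes x :: "nat \<Rightarrow> 'z::real_normed_vector"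
  assumes A: "A \<subseteq> {..<m}" and l: "\<And>i. i \<in> A \<Longrightarrow> l i < (r::nat)"
  shows "(\<Sum>\<epsilon>\<in>signs m. rad2 r (\<lambda>j. \<Sum>i\<in>{i\<in>A. l i = j}. \<epsilon> i *\<^sub>R x i)) / 2 ^ m \<le> rad2 m x"
proof -
  have fin: "finite A" using A finite_subset by blast
  have *: "(\<Sum>\<epsilon>\<in>signs m. (norm (\<Sum>j<r. \<delta> j *\<^sub>R (\<Sum>i\<in>{i\<in>A. l i = j}. \<epsilon> i *\<^sub>R x i)))\<^sup>2)
      = 2 ^ m * rad2 m (zero_outside A x)" if \<delta>: "\<delta> \<in> signs r" for \<delta>
  proof -
    define s where "s i = (if i \<in> A then \<delta> (l i) else 1)" for i
    have s: "s i \<in> {-1, 1}" for i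
      using signs_mem[OF \<delta>, of "l i"] l by (simp add: s_def)
    have "(\<Sum>j<r. \<delta> j *\<^sub>R (\<Sum>i\<in>{i\<in>A. l i = j}. \<epsilon> i *\<^sub>R x i)) = (\<Sum>i<m. \<epsilon> i *\<^sub>R s i *\<^sub>R zero_outside A x i)" for \<epsilon>
    proof -
      have "(\<Sum>j<r. \<delta> j *\<^sub>R (\<Sum>i\<in>{i\<in>A. l i = j}. \<epsilon> i *\<^sub>R x i))
          = (\<Sum>j<r. \<Sum>i\<in>{i\<in>A. l i = j}. (\<epsilon> i * s i) *\<^sub>R x i)"
        unfolding scaleR_sum_right by (intro sum.cong refl) (auto simp: s_def mult.commute)
      also have "\<dots> = (\<Sum>i\<in>A. (\<epsilon> i * s i) *\<^sub>R x i)"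
        using l by (intro sum.group fin) auto
      also have "\<dots> = (\<Sum>i<m. \<epsilon> i *\<^sub>R s i *\<^sub>R zero_outside A x i)"
        using sum_scaleR_zero_outside[OF A, of "\<lambda>i. \<epsilon> i * s i" x] by simp
      finally show ?thesis .
    qed
    then have "(\<Sum>\<epsilon>\<in>signs m. (norm (\<Sum>j<r. \<delta> j *\<^sub>R (\<Sum>i\<in>{i\<in>A. l i = j}. \<epsilon> i *\<^sub>R x i)))\<^sup>2)
        = 2 ^ m * rad2 m (\<lambda>i. s i *\<^sub>R zero_outside A x i)"
      by (simp add: rad2_def)
    also have "\<dots> = 2 ^ m * rad2 m (zero_outside A x)"
      using s by (subst rad2_flip) auto
    finally show ?thesis .
  qed
  have "(\<Sum>\<epsilon>\<in>signs m. rad2 r (\<lambda>j. \<Sum>i\<in>{i\<in>A. l i = j}. \<epsilon> i *\<^sub>R x i))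
      = (\<Sum>\<delta>\<in>signs r. \<Sum>\<epsilon>\<in>signs m. (norm (\<Sum>j<r. \<delta> j *\<^sub>R (\<Sum>i\<in>{i\<in>A. l i = j}. \<epsilon> i *\<^sub>R x i)))\<^sup>2) / 2 ^ r"
    unfolding rad2_def by (subst sum.swap) (simp add: sum_divide_distrib)
  also have "\<dots> = 2 ^ m * rad2 m (zero_outside A x)"
    by (simp add: * card_signs)
  finally show ?thesis
    using rad2_zero_outside_le[OF A, of x] by simp
qed


section \<open>Growth of the cotype 2 constants\<close>

text \<open>\<open>n\<close> bounds the number of nonzero vectors while \<open>m\<close> is free, so
  a family padded by \<open>zero_outside A\<close> counts as at most \<open>card A\<close> vectors.
  The value is the square of the best cotype 2 constant.\<close>

definition cotype2_fn :: "'z::real_normed_vector itself \<Rightarrow> nat \<Rightarrow> real" where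
  "cotype2_fn Z n = Sup {(\<Sum>i<m. (norm (x i))\<^sup>2) | m (x :: nat \<Rightarrow> 'z).
     rad2 m x \<le> 1 \<and> card {i. i < m \<and> x i \<noteq> 0} \<le> n}"

lemma sum_norm_support:
  fixes m :: nat
  shows "(\<Sum>i<m. (norm (x i))\<^sup>2) = (\<Sum>i\<in>{i. i < m \<and> x i \<noteq> 0}. (norm (x i))\<^sup>2)"
  by (rule sum.mono_neutral_right) auto

text \<open>Each vector has norm at most 1 by \<open>norm_le_rad2\<close>; this crude bound makes
  the supremum in \<open>cotype2_fn\<close> finite.\<close>

lemma cotype2_fn_aux:
  assumes "rad2 m x \<le> 1" "card {i. i < m \<and> x i \<noteq> 0} \<le> n"
  shows "(\<Sum>i<m. (norm (x i))\<^sup>2) \<le> real n"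
proof -
  have "(norm (x i))\<^sup>2 \<le> 1" if "i < m" for i
    using norm_le_rad2[OF that, of x] assms(1) by simp
  then have "(\<Sum>i\<in>{i. i < m \<and> x i \<noteq> 0}. (norm (x i))\<^sup>2) \<le> of_nat (card {i. i < m \<and> x i \<noteq> 0}) * 1"
    by (intro sum_bounded_above) auto
  then show ?thesis
    using assms(2) by (simp add: sum_norm_support[of x])
qed

lemma cotype2_fn_bdd:
  "bdd_above {(\<Sum>i<m. (norm (x i))\<^sup>2) | m (x :: nat \<Rightarrow> 'z::real_normed_vector).
     rad2 m x \<le> 1 \<and> card {i. i < m \<and> x i \<noteq> 0} \<le> n}"
  by (intro bdd_aboveI[of _ "real n"]) (auto intro: cotype2_fn_aux)

lemma cotype2_fn_nonempty:
  "0 \<in> {(\<Sum>i<m. (norm (x i))\<^sup>2) | m (x :: nat \<Rightarrow> 'z::real_normed_vector).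
     rad2 m x \<le> 1 \<and> card {i. i < m \<and> x i \<noteq> 0} \<le> n}"
  by (rule CollectI, rule exI[of _ 0], rule exI[of _ "\<lambda>_. 0"]) (simp add: rad2_def)

lemma cotype2_fn_nonneg: "0 \<le> cotype2_fn Z n"
  unfolding cotype2_fn_def by (rule cSup_upper[OF cotype2_fn_nonempty cotype2_fn_bdd])

lemma cotype2_fn_mono: "n \<le> n' \<Longrightarrow> cotype2_fn Z n \<le> cotype2_fn Z n'"
  unfolding cotype2_fn_def
  by (intro cSup_subset_mono cotype2_fn_bdd) (use cotype2_fn_nonempty in blast, fastforce)

lemma cotype2_fn_zero: "cotype2_fn (TYPE('z::real_normed_vector)) 0 \<le> 0"
  unfolding cotype2_fn_def
  by (rule cSup_least) (use cotype2_fn_nonempty in blast, fastforce dest: cotype2_fn_aux)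

lemma cotype2_fn_ineq:
  fixes x :: "nat \<Rightarrow> 'z::real_normed_vector"
  assumes "card {i. i < m \<and> x i \<noteq> 0} \<le> n"
  shows "(\<Sum>i<m. (norm (x i))\<^sup>2) \<le> cotype2_fn TYPE('z) n * rad2 m x"
proof (cases "rad2 m x = 0")
  case True
  then have "x i = 0" if "i < m" for i
    using norm_le_rad2[OF that, of x] by simp
  then show ?thesis using True by simp
next
  case False
  \<comment> \<open>Rescaling to average 1 makes the family a competitor in the supremum.\<close>
  define c where "c = 1 / sqrt (rad2 m x)"
  have pos: "rad2 m x > 0" using False rad2_nonneg[of m x] by simp
  have c: "c\<^sup>2 * rad2 m x = 1" "c \<noteq> 0"
    using pos by (auto simp: c_def power_divide)
  have "(\<Sum>i<m. (norm (c *\<^sub>R x i))\<^sup>2) \<le> cotype2_fn TYPE('z) n"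
    unfolding cotype2_fn_def
    by (rule cSup_upper[OF _ cotype2_fn_bdd], rule CollectI, rule exI[of _ m],
        rule exI[of _ "\<lambda>i. c *\<^sub>R x i"]) (use assms c in \<open>auto simp: rad2_scale\<close>)
  moreover have "(\<Sum>i<m. (norm (c *\<^sub>R x i))\<^sup>2) = c\<^sup>2 * (\<Sum>i<m. (norm (x i))\<^sup>2)"
    by (simp add: power_mult_distrib flip: sum_distrib_left)
  moreover have "c\<^sup>2 = 1 / rad2 m x"
    using pos by (simp add: c_def power_divide)
  ultimately have "(\<Sum>i<m. (norm (x i))\<^sup>2) / rad2 m x \<le> cotype2_fn TYPE('z) n"
    by simp
  then show ?thesis
    using pos by (simp add: pos_divide_le_eq)
qed

lemma cotype2_fn_attain:
  assumes "a < cotype2_fn TYPE('z::real_normed_vector) n"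
  obtains m and x :: "nat \<Rightarrow> 'z::real_normed_vector" where "rad2 m x \<le> 1" "card {i. i < m \<and> x i \<noteq> 0} \<le> n"
    "a < (\<Sum>i<m. (norm (x i))\<^sup>2)"
proof -
  let ?S = "{(\<Sum>i<m. (norm (x i))\<^sup>2) | m (x :: nat \<Rightarrow> 'z).
     rad2 m x \<le> 1 \<and> card {i. i < m \<and> x i \<noteq> 0} \<le> n}"
  have "a < Sup ?S"
    using assms by (simp add: cotype2_fn_def)
  then obtain s where "s \<in> ?S" "a < s"
    using less_cSupE[of a ?S] cotype2_fn_nonempty[where 'z='z] by (metis (no_types, lifting) empty_iff)
  then show ?thesis using that by auto
qed

text \<open>The smallest weight is at most the mean, hence at most
  \<open>K * card I powr (- b)\<close>. Removing it repeatedly shows that the \<open>n\<close>-th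
  largest weight is at most \<open>K * n powr (- b)\<close>, and the \<open>p\<close>-th powers are
  summed.\<close>

lemma sum_powr_le:
  fixes w :: "'i \<Rightarrow> real"
  assumes "finite I" and w: "\<And>i. i \<in> I \<Longrightarrow> 0 \<le> w i" and p: "0 < p"
    and K: "0 \<le> K" and sub: "\<And>A. A \<subseteq> I \<Longrightarrow> sum w A \<le> K * real (card A) powr (1 - b)"
  shows "(\<Sum>i\<in>I. w i powr p) \<le> K powr p * (\<Sum>n<card I. real (Suc n) powr (- b * p))"
  using assms(1) w sub
proof (induction "card I" arbitrary: I)
  case 0
  then show ?case by simp
next
  case (Suc n)
  have "I \<noteq> {}" using Suc.hyps(2) by auto
  define j where "j = arg_min_on w I"
  have j: "j \<in> I" "\<And>i. i \<in> I \<Longrightarrow> w j \<le> w i"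
    using arg_min_if_finite[OF Suc.prems(1) \<open>I \<noteq> {}\<close>, of w] by (auto simp: j_def not_less)
  have card: "card (I - {j}) = n" using j(1) Suc.hyps(2) Suc.prems(1) by simp
  have "real (card I) * w j \<le> sum w I"
    using sum_bounded_below[of I "w j" w] j(2) by simp
  also have "\<dots> \<le> K * real (Suc n) powr (1 - b)"
    using Suc.prems(3)[of I] Suc.hyps(2) by simp
  also have "\<dots> = real (card I) * (K * real (Suc n) powr (- b))"
    by (simp add: powr_diff powr_minus Suc.hyps(2)[symmetric] field_simps del: of_nat_Suc)
  finally have "w j \<le> K * real (Suc n) powr (- b)"
    using Suc.hyps(2) by (metis mult_le_cancel_left_pos of_nat_0_less_iff zero_less_Suc)
  then have "w j powr p \<le> (K * real (Suc n) powr (- b)) powr p"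
    using p Suc.prems(2) j(1) by (intro powr_mono2) auto
  also have "\<dots> = K powr p * real (Suc n) powr (- b * p)"
    using K by (simp add: powr_mult powr_powr)
  finally have 1: "w j powr p \<le> K powr p * real (Suc n) powr (- b * p)" .
  have 2: "(\<Sum>i\<in>I - {j}. w i powr p) \<le> K powr p * (\<Sum>n<n. real (Suc n) powr (- b * p))"
    using Suc.hyps(1)[of "I - {j}"] Suc.prems card by (metis (no_types, lifting) Diff_subset finite_Diff subset_iff subset_trans)
  have "(\<Sum>i\<in>I. w i powr p) = w j powr p + (\<Sum>i\<in>I - {j}. w i powr p)"
    using j(1) Suc.prems(1) by (simp add: sum.remove)
  also have "\<dots> \<le> K powr p * (\<Sum>n<Suc n. real (Suc n) powr (- b * p))"
    using 1 2 by (simp add: distrib_left)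
  finally show ?case using Suc.hyps(2) by simp
qed

lemma cotype2_fn_subset:
  fixes x :: "nat \<Rightarrow> 'z::real_normed_vector"
  assumes "A \<subseteq> {..<m}"
  shows "(\<Sum>i\<in>A. (norm (x i))\<^sup>2) \<le> cotype2_fn TYPE('z) (card A) * rad2 m (zero_outside A x)"
proof -
  have fin: "finite A" using assms finite_subset by blast
  have "(\<Sum>i<m. (norm (zero_outside A x i))\<^sup>2) \<le> cotype2_fn TYPE('z) (card A) * rad2 m (zero_outside A x)"
    by (rule cotype2_fn_ineq, rule card_mono[OF fin]) (auto simp: zero_outside_def split: if_splits)
  moreover have "(\<Sum>i<m. (norm (zero_outside A x i))\<^sup>2) = (\<Sum>i\<in>A. (norm (x i))\<^sup>2)"
  proof -
    have "(\<Sum>i<m. (norm (zero_outside A x i))\<^sup>2) = (\<Sum>i<m. if i \<in> A then (norm (x i))\<^sup>2 else 0)"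
      by (intro sum.cong) (auto simp: zero_outside_def)
    also have "\<dots> = (\<Sum>i\<in>A. (norm (x i))\<^sup>2)"
      using assms by (simp add: sum.If_cases Int_absorb1)
    finally show ?thesis .
  qed
  ultimately show ?thesis by simp
qed

text \<open>The growth bound controls sums of squares over all subsets, so by
  \<open>sum_powr_le\<close> the sorted squared norms decay like \<open>n powr (- b)\<close> with
  \<open>b = 1 - 2 * a\<close>; their powers \<open>q / 2\<close> are summable since
  \<open>b * (q / 2) > 1\<close>.\<close>

lemma has_cotype_if_cotype2_fn_le:
  assumes q: "2 < q" and a: "0 < a" "2 / q < 1 - 2 * a"
    and F: "\<And>n. cotype2_fn TYPE('z::real_normed_vector) n \<le> K * real n powr (2 * a)"
  shows "has_cotype TYPE('z) (ereal q)"
proof -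
  define b where "b = 1 - 2 * a"
  define S where "S = (\<Sum>n. real (Suc n) powr (- b * (q / 2)))"
  have bq: "1 < b * (q / 2)"
    using a q by (simp add: b_def field_simps)
  have "summable (\<lambda>n. real n powr (- b * (q / 2)))"
    using bq by (simp add: summable_real_powr_iff)
  then have summ: "summable (\<lambda>n. real (Suc n) powr (- b * (q / 2)))"
    by (subst summable_Suc_iff)
  have K: "0 \<le> K"
    using F[of 1] cotype2_fn_nonneg[of "TYPE('z)" 1] by simp
  define D where "D = K powr (q / 2) * S"
  have S: "0 \<le> S" unfolding S_def by (intro suminf_nonneg summ) simp
  have D: "0 \<le> D" using S by (simp add: D_def)
  \<comment> \<open>The added 1 keeps \<open>C\<close> positive even if
    \<open>D = 0\<close>.\<close>
  define C where "C = D powr (1 / q) + 1"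
  have "(\<Sum>i<m. norm (x i) powr q) powr (1 / q) \<le> C * rademacher_avg m x" for m and x :: "nat \<Rightarrow> 'z"
  proof -
    define Q where "Q = rad2 m x"
    have Q: "0 \<le> Q" by (simp add: Q_def rad2_nonneg)
    have w: "norm (x i) powr q = ((norm (x i))\<^sup>2) powr (q / 2)" for i
      by (cases "x i = 0") (simp_all add: powr_powr flip: powr_numeral)
    have sub: "(\<Sum>i\<in>A. (norm (x i))\<^sup>2) \<le> (K * Q) * real (card A) powr (1 - b)" if "A \<subseteq> {..<m}" for A
    proof -
      have "(\<Sum>i\<in>A. (norm (x i))\<^sup>2) \<le> cotype2_fn TYPE('z) (card A) * rad2 m (zero_outside A x)"
        by (rule cotype2_fn_subset[OF that])
      also have "\<dots> \<le> (K * real (card A) powr (2 * a)) * Q"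
        unfolding Q_def by (intro mult_mono F rad2_zero_outside_le that rad2_nonneg) (use K in simp)
      finally show ?thesis by (simp add: b_def mult_ac)
    qed
    have "(\<Sum>i<m. ((norm (x i))\<^sup>2) powr (q / 2))
        \<le> (K * Q) powr (q / 2) * (\<Sum>n<card {..<m}. real (Suc n) powr (- b * (q / 2)))"
      by (rule sum_powr_le) (use q K Q sub in auto)
    also have "\<dots> \<le> (K * Q) powr (q / 2) * S"
      unfolding S_def by (intro mult_left_mono sum_le_suminf summ) auto
    also have "\<dots> = D * Q powr (q / 2)"
      using K Q by (simp add: powr_mult D_def)
    finally have "(\<Sum>i<m. norm (x i) powr q) powr (1 / q) \<le> (D * Q powr (q / 2)) powr (1 / q)"
      using q by (intro powr_mono2) (auto simp: w intro: sum_nonneg)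
    also have "\<dots> = D powr (1 / q) * sqrt Q"
      using q D Q by (simp add: powr_mult powr_powr powr_half_sqrt)
    also have "\<dots> \<le> C * sqrt Q"
      using Q by (intro mult_right_mono) (auto simp: C_def)
    finally show ?thesis by (simp add: rademacher_avg_rad2 Q_def)
  qed
  moreover have "C > 0" using powr_ge_zero[of D "1 / q"] unfolding C_def by linarith
  ultimately show ?thesis unfolding has_cotype_def by auto
qed

text \<open>If the growth inequality failed at every \<open>P\<close> with
  \<open>F (k * P) > B\<close>, then from some power of \<open>k\<close> on each factor
  \<open>k\<close> would cost at most \<open>k powr c\<close>, and monotonicity would bound
  \<open>F n\<close> by a multiple of \<open>n powr c\<close>, against \<open>unb\<close>.\<close>

lemma growth_dichotomy:
  fixes F :: "nat \<Rightarrow> real"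
  assumes mono: "mono F" and F0: "F 0 \<le> 0" and nonneg: "\<And>n. 0 \<le> F n" and c: "0 < c" and k: "2 \<le> (k::nat)"
    and unb: "\<And>K. \<exists>n. K * real n powr c < F n"
  shows "\<exists>P. F (k * P) > real k powr c * F P \<and> F (k * P) > B"
proof -
  have kn: "n \<le> k ^ n" for n
  proof -
    have "n < 2 ^ n" by simp
    also have "\<dots> \<le> k ^ n" using k by (intro power_mono) auto
    finally show ?thesis by simp
  qed
  \<comment> \<open>Otherwise \<open>F\<close> is bounded by \<open>B\<close>, hence by
    \<open>B * n powr c\<close> for \<open>n \<ge> 1\<close>; the case \<open>n = 0\<close> is
    excluded by \<open>F0\<close>.\<close>
  have "\<exists>J. F (k ^ J) > B"
  proof (rule ccontr)
    assume "\<not> ?thesis"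
    then have *: "F (k ^ J) \<le> B" for J by (meson not_le)
    have B: "0 \<le> B" using *[of 0] nonneg[of 1] by simp
    obtain n where n: "B * real n powr c < F n" using unb by blast
    have "n \<noteq> 0"
    proof
      assume "n = 0"
      then show False using n F0 by simp
    qed
    have "F n \<le> F (k ^ n)" using kn mono by (simp add: monoD)
    also have "\<dots> \<le> B" by (rule *)
    also have "\<dots> \<le> B * real n powr c"
      using B c \<open>n \<noteq> 0\<close> ge_one_powr_ge_zero[of "real n" c] mult_left_mono[of 1 "real n powr c" B] by simp
    finally show False using n by simp
  qed
  then obtain J where J: "F (k ^ J) > B" by blast
  show ?thesis
  proof (rule ccontr)
    assume "\<not> ?thesis"
    then have not: "\<And>P. F (k * P) > B \<Longrightarrow> F (k * P) \<le> real k powr c * F P" by (meson not_le)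
    have step: "F (k ^ (J + Suc i)) \<le> real k powr c * F (k ^ (J + i))" for i
    proof -
      have "F (k ^ J) \<le> F (k ^ (J + Suc i))"
        using k by (intro monoD[OF mono] power_increasing) auto
      then show ?thesis using not[of "k ^ (J + i)"] J by simp
    qed
    have iter: "F (k ^ (J + i)) \<le> (real k powr c) ^ i * F (k ^ J)" for i
    proof (induction i)
      case 0
      then show ?case by simp
    next
      case (Suc i)
      have "F (k ^ (J + Suc i)) \<le> real k powr c * F (k ^ (J + i))" by (rule step)
      also have "\<dots> \<le> real k powr c * ((real k powr c) ^ i * F (k ^ J))"
        by (intro mult_left_mono Suc) simp
      finally show ?case by (simp add: mult_ac)
    qed
    define K where "K = real k powr c * F (k ^ J)"
    obtain n where n: "K * real n powr c < F n" using unb by blast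
    have n0: "n \<noteq> 0"
    proof
      assume "n = 0"
      then show False using n F0 by simp
    qed
    \<comment> \<open>Since \<open>i\<close> is least, \<open>k ^ (i - 1) < n\<close> unless
      \<open>i = 0\<close>. Rounding \<open>n\<close> up to a power of \<open>k\<close> therefore
      costs at most one factor \<open>k powr c\<close>, which is part of \<open>K\<close>.\<close>
    define i where "i = (LEAST i. n \<le> k ^ i)"
    have i: "n \<le> k ^ i" unfolding i_def by (rule LeastI[of _ n]) (rule kn)
    have pow: "(real k powr c) ^ i \<le> real k powr c * real n powr c"
    proof (cases i)
      case 0
      have "1 \<le> real k powr c" "1 \<le> real n powr c"
        using k n0 c by (auto intro!: ge_one_powr_ge_zero)
      then show ?thesis using 0 mult_mono[of 1 "real k powr c" 1 "real n powr c"] by simp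
    next
      case (Suc i')
      then have "\<not> n \<le> k ^ i'" unfolding i_def by (metis lessI not_less_Least)
      then have "(real k ^ i') powr c \<le> real n powr c"
        using c by (intro powr_mono2) (auto simp flip: of_nat_power)
      moreover have "(real k powr c) ^ i = real k powr c * (real k ^ i') powr c"
        using k Suc by (simp add: powr_power powr_realpow[symmetric] powr_powr mult.commute)
      ultimately show ?thesis by (simp add: mult_left_mono)
    qed
    have "F n \<le> F (k ^ (J + i))"
    proof (rule monoD[OF mono])
      have "k ^ i \<le> k ^ (J + i)" using k by (intro power_increasing) auto
      then show "n \<le> k ^ (J + i)" using i by simp
    qed
    also have "\<dots> \<le> (real k powr c) ^ i * F (k ^ J)" by (rule iter)
    also have "\<dots> \<le> (real k powr c * real n powr c) * F (k ^ J)"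
      by (intro mult_right_mono pow nonneg)
    also have "\<dots> = K * real n powr c" by (simp add: K_def)
    finally show False using n by simp
  qed
qed

text \<open>Peel off the weights above \<open>t / 2\<close>, where \<open>t\<close> is the largest
  weight: they contribute at most \<open>h * t\<close>, and the remaining weights are at most
  \<open>t / 2\<close>. The geometric series gives the factor 2.\<close>

lemma level_pigeonhole:
  fixes w :: "'i \<Rightarrow> real"
  assumes "finite J" and w: "\<And>i. i \<in> J \<Longrightarrow> 0 < w i" "\<And>i. i \<in> J \<Longrightarrow> w i \<le> M" and M: "0 \<le> M"
    and h: "\<And>t. card {i\<in>J. t / 2 < w i \<and> w i \<le> t} \<le> h"
  shows "sum w J \<le> 2 * real h * M"
  using assms
proof (induction "card J" arbitrary: J M rule: less_induct)
  case less
  show ?case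
  proof (cases "J = {}")
    case True
    then show ?thesis using less.prems by simp
  next
    case False
    define t where "t = Max (w ` J)"
    have "t \<in> w ` J" unfolding t_def by (rule Max_in) (use False less.prems(1) in auto)
    then obtain j where j: "j \<in> J" "w j = t" by auto
    have le: "w i \<le> t" if "i \<in> J" for i using that less.prems(1) by (simp add: t_def)
    have t: "0 < t" "t \<le> M" using j less.prems(2,3) by auto
    define U where "U = {i\<in>J. t / 2 < w i \<and> w i \<le> t}"
    have U: "U \<subseteq> J" "j \<in> U" using j t by (auto simp: U_def)
    have fin: "finite U" using U less.prems(1) finite_subset by blast
    have "sum w (J - U) \<le> 2 * real h * (t / 2)"
    proof (rule less.hyps)
      show "card (J - U) < card J"
        using U j less.prems(1) by (intro psubset_card_mono) auto
      show "w i \<le> t / 2" if "i \<in> J - U" for i using that le[of i] by (auto simp: U_def)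
      show "card {i \<in> J - U. t / 2 < w i \<and> w i \<le> t} \<le> h" for t
        by (rule order_trans[OF card_mono less.prems(5)[of t]]) (use less.prems(1) in auto)
    qed (use less.prems t in auto)
    moreover have "sum w U \<le> real (card U) * t"
      by (rule sum_bounded_above) (simp add: U_def)
    moreover have "real (card U) * t \<le> real h * t"
      using less.prems(5)[of t] t by (simp add: U_def)
    moreover have "sum w J = sum w (J - U) + sum w U"
      by (rule sum.subset_diff[OF U(1) less.prems(1)])
    ultimately have "sum w J \<le> 2 * real h * t" by simp
    also have "\<dots> \<le> 2 * real h * M" using t by (intro mult_left_mono) auto
    finally show ?thesis .
  qed
qed


section \<open>Exhaustion and Ramsey selection\<close>

text \<open>For a fixed sign vector the block sums are \<open>r\<close> vectors, to which the
  constant for \<open>r\<close> vectors applies. Averaging over the sign vectors,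
  \<open>rad2_blocks\<close> returns to the average of the whole family.\<close>

lemma sum_rad2_disjoint_le:
  fixes x :: "nat \<Rightarrow> 'z::real_normed_vector"
  assumes disj: "disjoint_family_on A {..<r}" and sub: "\<And>j. j < r \<Longrightarrow> A j \<subseteq> {..<m}"
  shows "(\<Sum>j<r. rad2 m (zero_outside (A j) x)) \<le> cotype2_fn TYPE('z) r * rad2 m x"
proof -
  define U where "U = (\<Union>j<r. A j)"
  define l where "l i = (SOME j. j < r \<and> i \<in> A j)" for i
  define y where "y \<epsilon> j = (\<Sum>i\<in>{i\<in>U. l i = j}. \<epsilon> i *\<^sub>R x i)" for \<epsilon> :: "nat \<Rightarrow> real" and j
  have l: "l i < r \<and> i \<in> A (l i)" if "i \<in> U" for i
    unfolding l_def by (rule someI_ex) (use that in \<open>auto simp: U_def\<close>)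
  have block: "{i\<in>U. l i = j} = A j" if "j < r" for j
  proof (intro set_eqI iffI)
    fix i assume "i \<in> A j"
    then have "i \<in> U" using that by (auto simp: U_def)
    then have "l i = j"
      using l[of i] disj that \<open>i \<in> A j\<close> unfolding disjoint_family_on_def by blast
    then show "i \<in> {i\<in>U. l i = j}" using \<open>i \<in> U\<close> by simp
  qed (use l in auto)
  have "(\<Sum>j<r. rad2 m (zero_outside (A j) x)) = (\<Sum>j<r. (\<Sum>\<epsilon>\<in>signs m. (norm (y \<epsilon> j))\<^sup>2) / 2 ^ m)"
    by (intro sum.cong refl) (simp add: rad2_def sum_scaleR_zero_outside sub y_def block)
  also have "\<dots> = (\<Sum>\<epsilon>\<in>signs m. \<Sum>j<r. (norm (y \<epsilon> j))\<^sup>2) / 2 ^ m"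
    by (subst sum.swap) (simp add: sum_divide_distrib)
  also have "\<dots> \<le> (\<Sum>\<epsilon>\<in>signs m. cotype2_fn TYPE('z) r * rad2 r (y \<epsilon>)) / 2 ^ m"
  proof (intro divide_right_mono sum_mono cotype2_fn_ineq)
    show "card {i. i < r \<and> y \<epsilon> i \<noteq> 0} \<le> r" for \<epsilon>
      by (rule order_trans[OF card_mono[of "{..<r}"]]) auto
  qed simp
  also have "\<dots> = cotype2_fn TYPE('z) r * ((\<Sum>\<epsilon>\<in>signs m. rad2 r (y \<epsilon>)) / 2 ^ m)"
    by (simp flip: sum_distrib_left)
  also have "\<dots> \<le> cotype2_fn TYPE('z) r * rad2 m x"
    unfolding y_def
    by (intro mult_left_mono rad2_blocks cotype2_fn_nonneg) (use l sub in \<open>auto simp: U_def\<close>)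
  finally show ?thesis .
qed

text \<open>A disjoint collection of \<open>k\<close>-subsets of \<open>I\<close> has at most
  \<open>P\<close> members, and \<open>sum_rad2_disjoint_le\<close> counts blocks rather than
  vectors; hence the discarded weight is charged with the constant for \<open>P\<close> instead of
  \<open>k * P\<close>.\<close>

lemma exhaustion:
  fixes x :: "nat \<Rightarrow> 'z::real_normed_vector"
  assumes k: "0 < k" and \<mu>: "0 < \<mu>" and I: "I \<subseteq> {..<m}" "card I \<le> k * P" and x: "rad2 m x \<le> 1"
  obtains J where "J \<subseteq> I"
    "\<And>A. A \<subseteq> J \<Longrightarrow> card A = k \<Longrightarrow> rad2 m (zero_outside A x) \<le> \<mu> * (\<Sum>i\<in>A. (norm (x i))\<^sup>2)"
    "(\<Sum>i\<in>I - J. (norm (x i))\<^sup>2) \<le> cotype2_fn TYPE('z) P / \<mu>"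
proof -
  define bad where "bad A \<longleftrightarrow> A \<subseteq> I \<and> card A = k \<and> \<mu> * (\<Sum>i\<in>A. (norm (x i))\<^sup>2) < rad2 m (zero_outside A x)" for A
  define \<FF> where "\<FF> = {F. F \<subseteq> Collect bad \<and> disjoint F}"
  have finI: "finite I" using I finite_subset by blast
  have finF: "finite F" if "F \<in> \<FF>" for F
  proof (rule finite_subset)
    show "F \<subseteq> Pow I" using that unfolding \<FF>_def bad_def by blast
  qed (simp add: finI)
  have "\<FF> \<subseteq> Pow (Pow I)" unfolding \<FF>_def bad_def by blast
  then have "finite \<FF>" by (rule finite_subset) (simp add: finI)
  moreover have "{} \<in> \<FF>" by (simp add: \<FF>_def)
  \<comment> \<open>A disjoint collection of bad sets with the most members; a further bad set
    inside \<open>J\<close> could be added to it.\<close>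
  ultimately obtain F where F: "F \<in> \<FF>" and F_max: "\<And>G. G \<in> \<FF> \<Longrightarrow> card G \<le> card F"
    using Max_in[of "card ` \<FF>"] Max_ge[of "card ` \<FF>"] by (metis (no_types, lifting) empty_iff finite_imageI imageE imageI)
  have badF: "bad A" if "A \<in> F" for A using F that by (auto simp: \<FF>_def)
  have disjF: "disjoint F" using F by (simp add: \<FF>_def)
  have finA: "finite A" if "A \<in> F" for A
    using badF[OF that] finI finite_subset unfolding bad_def by blast
  define J where "J = I - \<Union>F"
  have UF: "\<Union>F \<subseteq> I" using badF by (auto simp: bad_def)
  have J: "\<not> bad A" if A: "A \<subseteq> J" "card A = k" for A
  proof
    assume "bad A"
    \<comment> \<open>Nonemptiness, from \<open>k > 0\<close>, shows that a set disjoint from all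
      members is not itself a member, so \<open>insert A F\<close> is strictly larger than
      \<open>F\<close>.\<close>
    have "A \<noteq> {}" using A k by auto
    moreover have disjA: "A \<inter> B = {}" if "B \<in> F" for B using A that by (auto simp: J_def)
    ultimately have "A \<notin> F" by blast
    have "insert A F \<in> \<FF>"
      using \<open>bad A\<close> badF disjF disjA by (auto simp: \<FF>_def pairwise_insert disjnt_def)
    from F_max[OF this] show False
      using \<open>A \<notin> F\<close> finF[OF F] by simp
  qed
  have "card (\<Union>F) = (\<Sum>A\<in>F. card A)"
    by (rule card_Union_disjoint[OF disjF finA])
  also have "\<dots> = card F * k" using badF by (simp add: bad_def)
  finally have "card F * k \<le> card I" using card_mono[OF finI UF] by simp
  then have cardF: "card F \<le> P" using I k by (metis le_trans mult.commute mult_le_cancel1)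
  obtain e where e: "bij_betw e {..<card F} F"
    using ex_bij_betw_nat_finite[OF finF[OF F]] by (auto simp: atLeast0LessThan)
  have eF: "e j \<in> F" if "j < card F" for j using e that by (auto simp: bij_betw_def)
  have "\<mu> * (\<Sum>i\<in>\<Union>F. (norm (x i))\<^sup>2) = (\<Sum>A\<in>F. \<mu> * (\<Sum>i\<in>A. (norm (x i))\<^sup>2))"
    using finA disjF by (subst sum.Union_disjoint) (auto simp: sum_distrib_left pairwise_def disjnt_def)
  also have "\<dots> \<le> (\<Sum>A\<in>F. rad2 m (zero_outside A x))"
  proof (rule sum_mono)
    fix A assume "A \<in> F"
    then show "\<mu> * (\<Sum>i\<in>A. (norm (x i))\<^sup>2) \<le> rad2 m (zero_outside A x)"
      using badF[of A] by (simp add: bad_def)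
  qed
  also have "\<dots> = (\<Sum>j<card F. rad2 m (zero_outside (e j) x))"
    by (rule sum.reindex_bij_betw[OF e, symmetric])
  also have "\<dots> \<le> cotype2_fn TYPE('z) (card F) * rad2 m x"
  proof (rule sum_rad2_disjoint_le)
    show "disjoint_family_on e {..<card F}"
      unfolding disjoint_family_on_def
    proof (intro ballI impI)
      fix i j assume ij: "i \<in> {..<card F}" "j \<in> {..<card F}" "i \<noteq> j"
      then have "e i \<noteq> e j" using e by (auto simp: bij_betw_def inj_on_def)
      then show "e i \<inter> e j = {}" using disjF eF ij by (auto simp: pairwise_def disjnt_def)
    qed
    show "e j \<subseteq> {..<m}" if "j < card F" for j
      using badF[OF eF[OF that]] I by (auto simp: bad_def)
  qed
  also have "\<dots> \<le> cotype2_fn TYPE('z) P * 1"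
    by (intro mult_mono cotype2_fn_mono cardF x rad2_nonneg cotype2_fn_nonneg)
  finally have "(\<Sum>i\<in>\<Union>F. (norm (x i))\<^sup>2) \<le> cotype2_fn TYPE('z) P / \<mu>"
    using \<mu> by (simp add: field_simps)
  moreover have "I - J = \<Union>F" using UF by (auto simp: J_def)
  ultimately show ?thesis
    using that[of J] J unfolding bad_def J_def by (metis (no_types, lifting) Diff_subset not_le subset_trans)
qed

section \<open>Ramsey's theorem for sign patterns\<close>

lemma ramsey_finite_colours:
  fixes n k :: nat
  assumes "finite C"
  shows "\<exists>N::nat. \<forall>f. (\<forall>B\<in>nsets {..<N} k. f B \<in> C) \<longrightarrow>
       (\<exists>H c. H \<subseteq> {..<N} \<and> card H = n \<and> c \<in> C \<and> (\<forall>B\<in>nsets H k. f B = c))"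
proof -
  obtain e where e: "bij_betw e C {..<card C}"
    using ex_bij_betw_finite_nat[OF assms] by (auto simp: atLeast0LessThan)
  obtain N :: nat where N: "partn_lst {..<N} (replicate (card C) n) k"
    using ramsey_full by blast
  show ?thesis
  proof (intro exI[of _ N] allI impI)
    fix f assume f: "\<forall>B\<in>nsets {..<N} k. f B \<in> C"
    have ef: "(\<lambda>B. e (f B)) \<in> nsets {..<N} k \<rightarrow> {..<card C}"
      using f e by (auto simp: bij_betw_def)
    obtain i H where i: "i < length (replicate (card C) n)" and "H \<in> nsets {..<N} (replicate (card C) n ! i)"
      and mono: "(\<lambda>B. e (f B)) ` nsets H k \<subseteq> {i}"
      by (rule partn_lstE[OF N ef]) simp_all
    then have H: "H \<in> nsets {..<N} n" by simp
    obtain c where c: "c \<in> C" "e c = i" using i e by (metis bij_betw_iff_bijections length_replicate lessThan_iff)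
    have "f B = c" if B: "B \<in> nsets H k" for B
    proof -
      have "B \<in> nsets {..<N} k" using B H by (auto simp: nsets_def)
      then have "f B \<in> C" using f by simp
      moreover have "e (f B) = e c" using mono B c by auto
      ultimately show ?thesis using e c by (auto simp: bij_betw_def inj_on_def)
    qed
    then show "\<exists>H c. H \<subseteq> {..<N} \<and> card H = n \<and> c \<in> C \<and> (\<forall>B\<in>nsets H k. f B = c)"
      using H c by (auto simp: nsets_def)
  qed
qed

lemma sorted_list_of_image:
  fixes p :: "nat \<Rightarrow> nat"
  assumes "strict_mono_on {..<k} p"
  shows "sorted_list_of_set (p ` {..<k}) = map p [0..<k]"
proof -
  have "sorted_wrt (<) (map p [0..<k])"
    using assms by (auto simp: sorted_wrt_iff_nth_less strict_mono_on_def)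
  then have "sorted (map p [0..<k])" "distinct (map p [0..<k])"
    by (simp_all only: strict_sorted_iff)
  then have "sorted_list_of_set (set (map p [0..<k])) = map p [0..<k]"
    by (rule sorted_list_of_set.idem_if_sorted_distinct)
  then show ?thesis by (simp add: atLeast0LessThan)
qed

text \<open>Increasing maps \<open>p\<close> encode the \<open>k\<close>-subsets of the family
  enumerated by \<open>h\<close>, so that \<open>c\<close> assigns signs by rank and one pattern
  serves all subsets.\<close>

definition sign_homogeneous :: "nat \<Rightarrow> nat \<Rightarrow> 'i set \<Rightarrow> ('i \<Rightarrow> 'z::real_normed_vector) \<Rightarrow> real \<Rightarrow> bool" where
  "sign_homogeneous k n J x M \<longleftrightarrow> (\<exists>h c. h ` {..<n} \<subseteq> J \<and> inj_on h {..<n} \<and> c \<in> signs k \<and>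
     (\<forall>p. strict_mono_on {..<k} p \<longrightarrow> p ` {..<k} \<subseteq> {..<n} \<longrightarrow>
       norm (\<Sum>i<k. c i *\<^sub>R x (h (p i))) \<le> M))"

lemma sign_homogeneousE:
  assumes "sign_homogeneous k n J x M"
  obtains h c where "h ` {..<n} \<subseteq> J" "inj_on h {..<n}" "c \<in> signs k"
    "\<forall>p. strict_mono_on {..<k} p \<longrightarrow> p ` {..<k} \<subseteq> {..<n} \<longrightarrow>
      norm (\<Sum>i<k. c i *\<^sub>R x (h (p i))) \<le> M"
proof -
  from assms[unfolded sign_homogeneous_def] show ?thesis
  proof (elim exE conjE)
    fix h c
    assume *: "h ` {..<n} \<subseteq> J" "inj_on h {..<n}" "c \<in> signs k"
      and "\<forall>p. strict_mono_on {..<k} p \<longrightarrow> p ` {..<k} \<subseteq> {..<n} \<longrightarrow>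
        norm (\<Sum>i<k. c i *\<^sub>R x (h (p i))) \<le> M"
    then show ?thesis by (rule that)
  qed
qed

text \<open>Colour each \<open>k\<close>-subset of positions by a sign pattern, read in increasing
  order, whose signed sum has norm at most \<open>M\<close>. There are only \<open>2 ^ k\<close>
  patterns, and the Ramsey number \<open>N\<close> does not depend on \<open>J\<close>,
  \<open>x\<close> or \<open>M\<close>.\<close>

lemma sign_selection:
  "\<exists>N::nat. \<forall>(J :: 'i set) (x :: 'i \<Rightarrow> 'z::real_normed_vector) M.
      finite J \<and> N \<le> card J \<and> (\<forall>A\<subseteq>J. card A = k \<longrightarrow>
         (\<exists>\<epsilon>. (\<forall>a\<in>A. \<epsilon> a \<in> {-1, 1::real}) \<and> norm (\<Sum>a\<in>A. \<epsilon> a *\<^sub>R x a) \<le> M))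
      \<longrightarrow> sign_homogeneous k n J x M"
proof -
  obtain N :: nat where N:
    "\<forall>f. (\<forall>B\<in>nsets {..<N} k. f B \<in> signs k) \<longrightarrow>
       (\<exists>H c. H \<subseteq> {..<N} \<and> card H = n \<and> c \<in> signs k \<and> (\<forall>B\<in>nsets H k. f B = c))"
    by (rule exE[OF ramsey_finite_colours[OF finite_signs]])
  show ?thesis
  proof (intro exI[of _ N] allI impI, elim conjE)
    fix J :: "'i set" and x :: "'i \<Rightarrow> 'z" and M :: real
    assume J: "finite J" "N \<le> card J" and
      "\<forall>A\<subseteq>J. card A = k \<longrightarrow> (\<exists>\<epsilon>. (\<forall>a\<in>A. \<epsilon> a \<in> {-1, 1::real}) \<and> norm (\<Sum>a\<in>A. \<epsilon> a *\<^sub>R x a) \<le> M)"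
    then have A: "\<exists>\<epsilon>. (\<forall>a\<in>A. \<epsilon> a \<in> {-1, 1::real}) \<and> norm (\<Sum>a\<in>A. \<epsilon> a *\<^sub>R x a) \<le> M"
      if "A \<subseteq> J" "card A = k" for A
      using that by simp
    obtain g where g: "bij_betw g {..<card J} J"
      using ex_bij_betw_nat_finite[OF J(1)] by (auto simp: atLeast0LessThan)
    have ginj: "inj_on g {..<N}" using g J(2) by (auto simp: bij_betw_def intro: inj_on_subset)
    have gJ: "g i \<in> J" if "i < N" for i using g J(2) that by (auto simp: bij_betw_def)
    define L where "L B = sorted_list_of_set B" for B :: "nat set"
    define good where "good B c \<longleftrightarrow> norm (\<Sum>i<k. c i *\<^sub>R x (g (L B ! i))) \<le> M" for B and c :: "nat \<Rightarrow> real"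
    define f where "f B = (SOME c. c \<in> signs k \<and> good B c)" for B
    have f: "f B \<in> signs k \<and> good B (f B)" if B: "B \<in> nsets {..<N} k" for B
    proof -
      have B': "B \<subseteq> {..<N}" "finite B" "card B = k" using B by (auto simp: nsets_def)
      have "card (g ` B) = k"
        using B' ginj by (metis card_image inj_on_subset)
      then obtain \<epsilon> where \<epsilon>: "\<And>a. a \<in> g ` B \<Longrightarrow> \<epsilon> a \<in> {-1, 1::real}"
        "norm (\<Sum>a\<in>g ` B. \<epsilon> a *\<^sub>R x a) \<le> M"
        using A[of "g ` B"] gJ B' by (metis image_subsetI lessThan_iff subset_eq)
      \<comment> \<open>The given signs are transported to ranks in the sorted list of
        \<open>B\<close>; the restriction puts \<open>c\<close> into \<open>signs k\<close>.\<close>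
      define c where "c = (\<lambda>i\<in>{..<k}. \<epsilon> (g (L B ! i)))"
      have bij: "bij_betw (\<lambda>i. L B ! i) {..<k} B"
        by (rule bij_betw_nth) (use B' in \<open>auto simp: L_def\<close>)
      have LB: "L B ! i \<in> B" if "i < k" for i using bij that by (auto simp: bij_betw_def)
      have "c \<in> signs k"
        unfolding c_def by (rule restrict_PiE_iff[THEN iffD2]) (use \<epsilon>(1) LB in blast)
      moreover have "(\<Sum>a\<in>g ` B. \<epsilon> a *\<^sub>R x a) = (\<Sum>i<k. c i *\<^sub>R x (g (L B ! i)))"
      proof -
        have "(\<Sum>a\<in>g ` B. \<epsilon> a *\<^sub>R x a) = (\<Sum>b\<in>B. \<epsilon> (g b) *\<^sub>R x (g b))"
          using inj_on_subset[OF ginj B'(1)] by (simp add: sum.reindex)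
        also have "\<dots> = (\<Sum>i<k. \<epsilon> (g (L B ! i)) *\<^sub>R x (g (L B ! i)))"
          by (rule sum.reindex_bij_betw[OF bij, symmetric])
        finally show ?thesis by (simp add: c_def)
      qed
      ultimately have "c \<in> signs k \<and> good B c" using \<epsilon>(2) by (simp add: good_def)
      then show ?thesis unfolding f_def by (rule someI[of "\<lambda>c. c \<in> signs k \<and> good B c"])
    qed
    have "\<exists>H c. H \<subseteq> {..<N} \<and> card H = n \<and> c \<in> signs k \<and> (\<forall>B\<in>nsets H k. f B = c)"
      by (rule N[rule_format]) (simp add: f)
    then obtain H where "\<exists>c. H \<subseteq> {..<N} \<and> card H = n \<and> c \<in> signs k \<and> (\<forall>B\<in>nsets H k. f B = c)"
      by (rule exE)
    then obtain c where Hc: "H \<subseteq> {..<N} \<and> card H = n \<and> c \<in> signs k \<and> (\<forall>B\<in>nsets H k. f B = c)"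
      by (rule exE)
    then have H: "H \<subseteq> {..<N}" "card H = n" and fc: "\<forall>B\<in>nsets H k. f B = c"
      by simp_all
    have c: "c \<in> signs k" using Hc by (elim conjE)
    have finH: "finite H" using H(1) finite_subset by blast
    have bijH: "bij_betw (\<lambda>i. L H ! i) {..<n} H"
      by (rule bij_betw_nth) (use H finH in \<open>auto simp: L_def\<close>)
    have LH: "L H ! i \<in> H" if "i < n" for i using bijH that by (auto simp: bij_betw_def)
    have LHmono: "L H ! i < L H ! j" if "i < j" "j < n" for i j
      using that H(2) strict_sorted_list_of_set[of H] by (simp add: L_def sorted_wrt_nth_less)
    define h where "h i = g (L H ! i)" for i
    have "h ` {..<n} \<subseteq> J" using LH H(1) gJ by (auto simp: h_def)
    moreover have "inj_on h {..<n}"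
    proof -
      have "inj_on g H" using ginj H(1) inj_on_subset by blast
      then have "inj_on (g \<circ> (\<lambda>i. L H ! i)) {..<n}"
        using bijH by (intro comp_inj_on) (auto simp: bij_betw_def)
      then show ?thesis by (simp add: h_def[abs_def] o_def)
    qed
    moreover have "norm (\<Sum>i<k. c i *\<^sub>R x (h (p i))) \<le> M"
      if p: "strict_mono_on {..<k} p" "p ` {..<k} \<subseteq> {..<n}" for p
    proof -
      \<comment> \<open>The positions selected by \<open>p\<close> form a \<open>k\<close>-subset of
        \<open>H\<close> whose sorted list is given by \<open>q\<close>, so the common colour
        \<open>c\<close> is applied in the right order.\<close>
      define q where "q i = L H ! p i" for i
      have q: "strict_mono_on {..<k} q"
        unfolding q_def by (rule strict_mono_onI, rule LHmono) (use p in \<open>auto simp: strict_mono_on_def\<close>)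
      then have "card (q ` {..<k}) = k" by (simp add: card_image strict_mono_on_imp_inj_on)
      moreover have "q ` {..<k} \<subseteq> H" using p(2) LH by (auto simp: q_def)
      ultimately have B: "q ` {..<k} \<in> nsets H k" by (simp add: nsets_def)
      then have "q ` {..<k} \<in> nsets {..<N} k" using H(1) nsets_mono by blast
      then have "good (q ` {..<k}) c" using f bspec[OF fc B] by metis
      moreover have "L (q ` {..<k}) = map q [0..<k]"
        unfolding L_def by (rule sorted_list_of_image[OF q])
      ultimately show ?thesis by (simp add: good_def h_def q_def)
    qed
    ultimately show "sign_homogeneous k n J x M"
      unfolding sign_homogeneous_def using c by (intro exI[of _ h] exI[of _ c] conjI allI impI)
  qed
qed


section \<open>Norming functionals\<close>

definition sublinear :: "('z::real_normed_vector \<Rightarrow> real) \<Rightarrow> bool" where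
  "sublinear q \<longleftrightarrow> (\<forall>x y. q (x + y) \<le> q x + q y) \<and> (\<forall>t x. 0 \<le> t \<longrightarrow> q (t *\<^sub>R x) = t * q x)"

lemma sublinearD:
  assumes "sublinear q"
  shows "q (x + y) \<le> q x + q y" "0 \<le> t \<Longrightarrow> q (t *\<^sub>R x) = t * q x" "q 0 = 0" "- q (- x) \<le> q x"
proof -
  show 1: "q (x + y) \<le> q x + q y" for x y using assms by (auto simp: sublinear_def)
  show 2: "0 \<le> t \<Longrightarrow> q (t *\<^sub>R x) = t * q x" for t x using assms by (auto simp: sublinear_def)
  show 3: "q 0 = 0" using 2[of 0 0] by simp
  show "- q (- x) \<le> q x" using 1[of x "- x"] 3 by simp
qed

lemma sublinearI:
  assumes add: "\<And>x y. q (x + y) \<le> q x + q y" and le: "\<And>t x. 0 < t \<Longrightarrow> q (t *\<^sub>R x) \<le> t * q x"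
    and zero: "q 0 = 0"
  shows "sublinear q"
  unfolding sublinear_def
proof (intro conjI allI impI add)
  fix t :: real and x
  assume "0 \<le> t"
  show "q (t *\<^sub>R x) = t * q x"
  proof (cases "t = 0")
    case False
    then have t: "0 < t" using \<open>0 \<le> t\<close> by simp
    have "q (inverse t *\<^sub>R t *\<^sub>R x) \<le> inverse t * q (t *\<^sub>R x)" using t by (intro le) simp
    then have "t * q x \<le> q (t *\<^sub>R x)" using t by (simp add: field_simps)
    then show ?thesis using le[OF t, of x] by simp
  qed (simp add: zero)
qed

text \<open>
  The Hahn-Banach theorem is obtained from minimal sublinear functionals: \<open>flatten q y\<close> is a
  sublinear functional below \<open>q\<close> that is additive in the direction \<open>y\<close>, so minimality forces linearity.
\<close>

definition flatten :: "('z::real_normed_vector \<Rightarrow> real) \<Rightarrow> 'z \<Rightarrow> 'z \<Rightarrow> real" where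
  "flatten q y x = (INF t\<in>{0..}. q (x + t *\<^sub>R y) - t * q y)"

lemma
  assumes q: "sublinear q"
  shows flatten_lower: "0 \<le> t \<Longrightarrow> flatten q y x \<le> q (x + t *\<^sub>R y) - t * q y"
    and flatten_greatest: "(\<And>t. 0 \<le> t \<Longrightarrow> a \<le> q (x + t *\<^sub>R y) - t * q y) \<Longrightarrow> a \<le> flatten q y x"
proof -
  \<comment> \<open>Subadditivity bounds the infimum from below, so it is finite.\<close>
  have "- q (- x) \<le> q (x + t *\<^sub>R y) - t * q y" if "0 \<le> t" for t
    using sublinearD(1)[OF q, of "x + t *\<^sub>R y" "- x"] sublinearD(2)[OF q that, of y] by simp
  then have bdd: "bdd_below ((\<lambda>t. q (x + t *\<^sub>R y) - t * q y) ` {0..})"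
    by (intro bdd_belowI2[where m = "- q (- x)"]) auto
  show "0 \<le> t \<Longrightarrow> flatten q y x \<le> q (x + t *\<^sub>R y) - t * q y"
    unfolding flatten_def by (rule cINF_lower[OF bdd]) simp
  show "(\<And>t. 0 \<le> t \<Longrightarrow> a \<le> q (x + t *\<^sub>R y) - t * q y) \<Longrightarrow> a \<le> flatten q y x"
    unfolding flatten_def by (rule cINF_greatest) auto
qed

lemma flatten_le: "sublinear q \<Longrightarrow> flatten q y x \<le> q x"
  using flatten_lower[of q 0 y x] by simp

lemma flatten_uminus_le: "sublinear q \<Longrightarrow> flatten q y (- y) \<le> - q y"
  using flatten_lower[of q 1 y "- y"] by (simp add: sublinearD)

text \<open>The parameters in the infimum add under sums of arguments and scale with the argument,
  so both properties of \<open>q\<close> are inherited.\<close>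

lemma sublinear_flatten:
  assumes q: "sublinear q"
  shows "sublinear (flatten q y)"
proof (rule sublinearI)
  fix x1 x2
  have *: "flatten q y (x1 + x2) - (q (x2 + t2 *\<^sub>R y) - t2 * q y) \<le> flatten q y x1" if t2: "0 \<le> t2" for t2
  proof (rule flatten_greatest[OF q])
    fix t1 :: real assume t1: "0 \<le> t1"
    have "flatten q y (x1 + x2) \<le> q (x1 + x2 + (t1 + t2) *\<^sub>R y) - (t1 + t2) * q y"
      using t1 t2 by (intro flatten_lower[OF q]) simp
    also have "q (x1 + x2 + (t1 + t2) *\<^sub>R y) \<le> q (x1 + t1 *\<^sub>R y) + q (x2 + t2 *\<^sub>R y)"
      using sublinearD(1)[OF q, of "x1 + t1 *\<^sub>R y" "x2 + t2 *\<^sub>R y"]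
      by (simp add: algebra_simps)
    finally show "flatten q y (x1 + x2) - (q (x2 + t2 *\<^sub>R y) - t2 * q y) \<le> q (x1 + t1 *\<^sub>R y) - t1 * q y"
      by (simp add: algebra_simps)
  qed
  have "flatten q y (x1 + x2) - flatten q y x1 \<le> flatten q y x2"
  proof (rule flatten_greatest[OF q])
    fix t :: real assume "0 \<le> t"
    from *[OF this] show "flatten q y (x1 + x2) - flatten q y x1 \<le> q (x2 + t *\<^sub>R y) - t * q y"
      by simp
  qed
  then show "flatten q y (x1 + x2) \<le> flatten q y x1 + flatten q y x2" by simp
next
  fix t :: real and x
  assume t: "0 < t"
  have "inverse t * flatten q y (t *\<^sub>R x) \<le> flatten q y x"
  proof (rule flatten_greatest[OF q])
    fix s :: real assume s: "0 \<le> s"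
    have "flatten q y (t *\<^sub>R x) \<le> q (t *\<^sub>R x + (t * s) *\<^sub>R y) - (t * s) * q y"
      using t s by (intro flatten_lower[OF q]) simp
    also have "t *\<^sub>R x + (t * s) *\<^sub>R y = t *\<^sub>R (x + s *\<^sub>R y)" by (simp add: scaleR_add_right)
    also have "q \<dots> = t * q (x + s *\<^sub>R y)" using t by (simp add: sublinearD(2)[OF q])
    finally show "inverse t * flatten q y (t *\<^sub>R x) \<le> q (x + s *\<^sub>R y) - s * q y"
      using t by (simp add: field_simps)
  qed
  then show "flatten q y (t *\<^sub>R x) \<le> t * flatten q y x" using t by (simp add: field_simps)
next
  have "0 \<le> flatten q y 0"
    by (rule flatten_greatest[OF q]) (simp add: sublinearD[OF q])
  then show "flatten q y 0 = 0" using flatten_le[OF q, of y 0] sublinearD(3)[OF q] by simp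
qed

text \<open>The infimum is finite because every member lies above \<open>- p (- x)\<close>. For
  subadditivity, any two members \<open>q\<close> and \<open>r\<close> have a common lower bound in
  the chain.\<close>

lemma sublinear_INF_chain:
  fixes C :: "('z::real_normed_vector \<Rightarrow> real) set"
  assumes sub: "\<And>q. q \<in> C \<Longrightarrow> sublinear q" and le: "\<And>q. q \<in> C \<Longrightarrow> q \<le> p" and "C \<noteq> {}"
    and chain: "\<And>q r. q \<in> C \<Longrightarrow> r \<in> C \<Longrightarrow> q \<le> r \<or> r \<le> q"
  shows "sublinear (\<lambda>x. INF q\<in>C. q x)" "\<And>q x. q \<in> C \<Longrightarrow> (INF q\<in>C. q x) \<le> q x"
proof -
  have "bdd_below ((\<lambda>q. q x) ` C)" for x
  proof (rule bdd_belowI2)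
    fix q assume q: "q \<in> C"
    show "- p (- x) \<le> q x" using sublinearD(4)[OF sub[OF q], of x] le_funD[OF le[OF q], of "- x"] by linarith
  qed
  then show lower: "(INF q\<in>C. q x) \<le> q x" if "q \<in> C" for q x
    using that by (intro cINF_lower)
  have greatest: "a \<le> (INF q\<in>C. q x)" if "\<And>q. q \<in> C \<Longrightarrow> a \<le> q x" for a x
    using that \<open>C \<noteq> {}\<close> by (intro cINF_greatest)
  show "sublinear (\<lambda>x. INF q\<in>C. q x)"
  proof (rule sublinearI)
    fix x y
    have *: "(INF q\<in>C. q (x + y)) \<le> q x + r y" if qr: "q \<in> C" "r \<in> C" for q r
    proof -
      obtain s where s: "s \<in> C" "s \<le> q" "s \<le> r" using chain[OF qr] qr by blast
      have "(INF q\<in>C. q (x + y)) \<le> s x + s y"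
        using lower[OF s(1)] sublinearD(1)[OF sub[OF s(1)]] order_trans by blast
      also have "\<dots> \<le> q x + r y" using s by (auto simp: le_fun_def intro: add_mono)
      finally show ?thesis .
    qed
    have "(INF q\<in>C. q (x + y)) - (INF q\<in>C. q x) \<le> (INF q\<in>C. q y)"
    proof (rule greatest)
      fix r assume r: "r \<in> C"
      have "(INF q\<in>C. q (x + y)) - r y \<le> (INF q\<in>C. q x)"
        by (rule greatest) (use *[OF _ r] in \<open>simp add: algebra_simps\<close>)
      then show "(INF q\<in>C. q (x + y)) - (INF q\<in>C. q x) \<le> r y" by simp
    qed
    then show "(INF q\<in>C. q (x + y)) \<le> (INF q\<in>C. q x) + (INF q\<in>C. q y)" by simp
  next
    fix t :: real and x assume t: "0 < t"
    have "inverse t * (INF q\<in>C. q (t *\<^sub>R x)) \<le> (INF q\<in>C. q x)"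
    proof (rule greatest)
      fix q assume q: "q \<in> C"
      show "inverse t * (INF q\<in>C. q (t *\<^sub>R x)) \<le> q x"
        using lower[OF q, of "t *\<^sub>R x"] sublinearD(2)[OF sub[OF q], of t x] t by (simp add: field_simps)
    qed
    then show "(INF q\<in>C. q (t *\<^sub>R x)) \<le> t * (INF q\<in>C. q x)" using t by (simp add: field_simps)
  next
    show "(INF q\<in>C. q 0) = 0"
      using \<open>C \<noteq> {}\<close> by (simp add: sublinearD(3)[OF sub] cong: INF_cong)
  qed
qed

text \<open>Minimality gives \<open>flatten q y = q\<close>; the parameter 1 in the infimum then
  yields the reverse of subadditivity.\<close>

lemma minimal_sublinear_linear:
  assumes q: "sublinear q" and min: "\<And>r. sublinear r \<Longrightarrow> r \<le> q \<Longrightarrow> r = q"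
  shows "linear q"
proof -
  have add: "q (x + y) = q x + q y" for x y
  proof -
    have "flatten q y = q"
      by (rule min) (auto simp: sublinear_flatten q le_fun_def flatten_le)
    then have "q x \<le> q (x + y) - q y"
      using flatten_lower[OF q, of 1 y x] by simp
    then show ?thesis using sublinearD(1)[OF q, of x y] by simp
  qed
  have neg: "q (- x) = - q x" for x using add[of x "- x"] sublinearD(3)[OF q] by simp
  have "q (t *\<^sub>R x) = t *\<^sub>R q x" for t x
  proof (cases "0 \<le> t")
    case False
    then show ?thesis using sublinearD(2)[OF q, of "- t" x] neg[of "t *\<^sub>R x"] by simp
  qed (simp add: sublinearD(2)[OF q])
  then show ?thesis using add by (intro linearI)
qed

lemma linear_below_sublinear:
  fixes p :: "'z::real_normed_vector \<Rightarrow> real"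
  assumes p: "sublinear p"
  obtains f where "linear f" "\<And>x. f x \<le> p x"
proof -
  define S where "S = {q. sublinear q \<and> q \<le> p}"
  \<comment> \<open>The order is reversed so that Zorn's lemma produces a minimal functional. A
    chain is bounded by its pointwise infimum, the empty chain by \<open>p\<close>.\<close>
  have "\<exists>m\<in>S. \<forall>a\<in>S. m \<ge> a \<longrightarrow> a = m"
  proof (rule predicate_Zorn)
    show "partial_order_on S (relation_of (\<ge>) S)"
      by (rule partial_order_on_relation_ofI) auto
    fix C assume C: "C \<in> Chains (relation_of (\<ge>) S)"
    have CS: "C \<subseteq> S" using C by (auto simp: Chains_def relation_of_def)
    show "\<exists>u\<in>S. \<forall>a\<in>C. a \<ge> u"
    proof (cases "C = {}")
      case True
      then show ?thesis using p by (auto simp: S_def)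
    next
      case False
      have *: "\<And>q. q \<in> C \<Longrightarrow> sublinear q" "\<And>q. q \<in> C \<Longrightarrow> q \<le> p" using CS by (auto simp: S_def)
      have chain: "q \<le> r \<or> r \<le> q" if "q \<in> C" "r \<in> C" for q r
        using C that by (auto simp: Chains_def relation_of_def)
      note inf = sublinear_INF_chain[OF * False chain]
      obtain q where "q \<in> C" using False by blast
      then have "(\<lambda>x. INF q\<in>C. q x) \<le> p" using inf(2) *(2) by (fastforce simp: le_fun_def intro: order_trans)
      then show ?thesis using inf by (intro bexI[of _ "\<lambda>x. INF q\<in>C. q x"]) (auto simp: S_def le_fun_def)
    qed
  qed
  then obtain f where f: "f \<in> S" "\<And>a. a \<in> S \<Longrightarrow> a \<le> f \<Longrightarrow> a = f" by blast
  have "linear f"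
  proof (rule minimal_sublinear_linear)
    show "sublinear f" using f by (simp add: S_def)
    show "r = f" if "sublinear r" "r \<le> f" for r
      using f that by (auto simp: S_def intro: order_trans)
  qed
  then show ?thesis using that[of f] f by (auto simp: S_def le_fun_def)
qed

text \<open>A linear functional below \<open>flatten norm z\<close> has
  \<open>f (- z) \<le> - norm z\<close>, which forces it to norm \<open>z\<close>.\<close>

lemma norming_functional:
  fixes z :: "'z::real_normed_vector"
  obtains f where "linear f" "\<And>x. \<bar>f x\<bar> \<le> norm x" "f z = norm z"
proof -
  have n: "sublinear (norm :: 'z \<Rightarrow> real)" by (simp add: sublinear_def norm_triangle_ineq)
  obtain f where f: "linear f" "\<And>x. f x \<le> flatten norm z x"
    using linear_below_sublinear[OF sublinear_flatten[OF n, of z]] by blast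
  have le: "f x \<le> norm x" for x using f(2) flatten_le[OF n] order_trans by blast
  have "\<bar>f x\<bar> \<le> norm x" for x
    using le[of x] le[of "- x"] linear_neg[OF f(1), of x] by simp
  moreover have "f z = norm z"
    using f(2)[of "- z"] flatten_uminus_le[OF n, of z] le[of z] linear_neg[OF f(1), of z] by simp
  ultimately show ?thesis using that f(1) by blast
qed

lemma norming_functional_complex:
  fixes z :: "'z::real_normed_vector" and scaleC :: "complex \<Rightarrow> 'z \<Rightarrow> 'z"
  assumes "normed_space_over scaleC"
  obtains f where "Vector_Spaces.linear scaleC (*) f" "\<And>x. norm (f x) \<le> norm x" "f z = of_real (norm z)"
proof -
  interpret normed_space_over scaleC by fact
  obtain g where g: "linear g" "\<And>x. \<bar>g x\<bar> \<le> norm x" "g z = norm z"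
    using norming_functional[of z] by blast
  \<comment> \<open>A complex linear functional with real part \<open>g\<close> must have imaginary
    part \<open>- g (scaleC \<i> x)\<close>.\<close>
  define f where "f x = Complex (g x) (- g (scaleC \<i> x))" for x
  have real: "scaleC (of_real t) x = t *\<^sub>R x" for t x by (rule scale_of_real)
  have ii: "scaleC \<i> (scaleC \<i> x) = - x" for x
    using real[of "-1" x] by simp
  have f_scale: "f (scaleC c x) = c * f x" for c x
  proof -
    have c: "scaleC c x = Re c *\<^sub>R x + Im c *\<^sub>R scaleC \<i> x" for x
    proof -
      have "c = of_real (Re c) + of_real (Im c) * \<i>" by (simp add: complex_eq_iff)
      then have "scaleC c x = scaleC (of_real (Re c) + of_real (Im c) * \<i>) x" by simp
      also have "\<dots> = Re c *\<^sub>R x + Im c *\<^sub>R scaleC \<i> x"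
        unfolding scale_left_distrib scale_scale[symmetric] real ..
      finally show ?thesis .
    qed
    have "scaleC \<i> (scaleC c x) = scaleC c (scaleC \<i> x)"
      by (simp add: mult.commute)
    also have "\<dots> = Re c *\<^sub>R scaleC \<i> x - Im c *\<^sub>R x"
      unfolding c[of "scaleC \<i> x"] ii by simp
    finally have "g (scaleC \<i> (scaleC c x)) = Re c * g (scaleC \<i> x) - Im c * g x"
      by (simp only: linear_diff[OF g(1)] linear_scale[OF g(1)] real_scaleR_def)
    moreover have "g (scaleC c x) = Re c * g x + Im c * g (scaleC \<i> x)"
      unfolding c[of x] by (simp only: linear_add[OF g(1)] linear_scale[OF g(1)] real_scaleR_def)
    ultimately show ?thesis
      by (simp add: f_def complex_eq_iff)
  qed
  have f_add: "f (x + y) = f x + f y" for x y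
    by (simp add: f_def scale_right_distrib linear_add[OF g(1)] complex_eq_iff)
  have lin: "Vector_Spaces.linear scaleC (*) f"
  proof -
    have "module_hom scaleC (*) f"
      by unfold_locales (auto simp: f_scale f_add algebra_simps)
    then show ?thesis
      by (simp add: module_hom_iff_linear)
  qed
  have le: "norm (f x) \<le> norm x" for x
  proof (cases "f x = 0")
    case False
    \<comment> \<open>Rotating \<open>x\<close> by a unimodular scalar makes the value of
      \<open>f\<close> real, where it coincides with that of \<open>g\<close>.\<close>
    define c where "c = cnj (sgn (f x))"
    have c: "norm c = 1" using False by (simp add: c_def norm_sgn)
    have fc: "f (scaleC c x) = of_real (norm (f x))"
      using False by (simp add: f_scale c_def sgn_eq complex_norm_square[symmetric] power2_eq_square field_simps)
    then have "norm (f x) = g (scaleC c x)"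
      by (simp add: f_def complex_eq_iff)
    also have "\<dots> \<le> norm x"
      using g(2)[of "scaleC c x"] c by (simp add: norm_scale)
    finally show ?thesis .
  qed simp
  \<comment> \<open>Since \<open>norm (f z) \<le> norm z\<close> and the real part is already
    \<open>norm z\<close>, the imaginary part vanishes.\<close>
  have "Re (f z) = norm z" by (simp add: f_def g(3))
  then have "f z = of_real (norm z)"
  proof -
    have "(Re (f z))\<^sup>2 + (Im (f z))\<^sup>2 \<le> (norm z)\<^sup>2"
      using power_mono[OF le[of z], of 2] by (simp add: cmod_power2)
    then have "Im (f z) = 0" using \<open>Re (f z) = norm z\<close> by simp
    then show ?thesis using \<open>Re (f z) = norm z\<close> by (simp add: complex_eq_iff)
  qed
  then show ?thesis using that lin le by blast
qed


section \<open>From the Orlicz property to cotype\<close>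

text \<open>Otherwise all vectors stay within \<open>\<tau> / 4\<close> of \<open>x (g 0)\<close>,
  and a functional norming \<open>x (g 0)\<close> is at least \<open>\<tau> / 4\<close> on each of
  them. By \<open>rad2_linear_le\<close> the average would then be too large.\<close>

lemma separated_pair_in_block:
  fixes x :: "nat \<Rightarrow> 'z::real_normed_vector"
  assumes g: "inj_on g {..<k}" "g ` {..<k} \<subseteq> {..<m}" and k: "0 < k" and \<tau>: "0 < \<tau>"
    and x: "\<And>u. u < k \<Longrightarrow> \<tau> / 2 \<le> norm (x (g u))"
    and r: "rad2 m (zero_outside (g ` {..<k}) x) < real k * (\<tau> / 4)\<^sup>2"
  shows "\<exists>u<k. \<exists>v<k. \<tau> / 4 < norm (x (g v) - x (g u))"
proof (rule ccontr)
  assume "\<not> ?thesis"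
  then have close: "norm (x (g v) - x (g 0)) \<le> \<tau> / 4" if "v < k" for v
    using that k by (meson not_le)
  obtain f where f: "linear f" "\<And>z. \<bar>f z\<bar> \<le> norm z" "f (x (g 0)) = norm (x (g 0))"
    using norming_functional[of "x (g 0)"] by blast
  have "\<tau> / 4 \<le> f (x (g v))" if "v < k" for v
    using f(2)[of "x (g v) - x (g 0)"] close[OF that] x[OF k] linear_diff[OF f(1), of "x (g v)" "x (g 0)"] f(3)
    by linarith
  then have "real k * (\<tau> / 4)\<^sup>2 \<le> (\<Sum>v<k. (f (x (g v)))\<^sup>2)"
    using \<tau> sum_bounded_below[of "{..<k}" "(\<tau> / 4)\<^sup>2" "\<lambda>v. (f (x (g v)))\<^sup>2"] by (simp add: power_mono)
  also have "\<dots> = (\<Sum>i\<in>g ` {..<k}. (f (x i))\<^sup>2)"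
    using g(1) by (simp add: sum.reindex)
  also have "\<dots> = (\<Sum>i\<in>g ` {..<k}. (f (zero_outside (g ` {..<k}) x i))\<^sup>2)"
    by (intro sum.cong) (auto simp: zero_outside_def)
  also have "\<dots> \<le> (\<Sum>i<m. (f (zero_outside (g ` {..<k}) x i))\<^sup>2)"
    using g(2) by (intro sum_mono2) auto
  also have "\<dots> \<le> rad2 m (zero_outside (g ` {..<k}) x)"
    by (rule rad2_linear_le[OF f(1,2)])
  finally show False using r by simp
qed

text \<open>Position \<open>i * k + w i\<close> lies in the \<open>i\<close>-th block of length
  \<open>k\<close>, so any choice of one position per block is an increasing selection. Hence
  \<open>u i\<close> and \<open>v i\<close> may be exchanged independently in each block, which
  reverses the sign of that difference.\<close>

lemma sign_sum_of_differences:
  fixes x :: "nat \<Rightarrow> 'z::real_normed_vector"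
  assumes c: "c \<in> signs k" and s: "s \<in> signs k"
    and uv: "\<And>i. i < k \<Longrightarrow> u i < k" "\<And>i. i < k \<Longrightarrow> v i < k"
    and sel: "\<And>p. strict_mono_on {..<k} p \<Longrightarrow> p ` {..<k} \<subseteq> {..<k * k} \<Longrightarrow> norm (\<Sum>i<k. c i *\<^sub>R x (p i)) \<le> M"
  shows "norm (\<Sum>i<k. s i *\<^sub>R (x (i * k + v i) - x (i * k + u i))) \<le> 2 * M"
proof -
  have block: "norm (\<Sum>i<k. c i *\<^sub>R x (i * k + w i)) \<le> M" if w: "\<And>i. i < k \<Longrightarrow> w i < k" for w
  proof (rule sel)
    have less: "i * k + w i < Suc i * k" if "i < k" for i using w[OF that] by simp
    show "strict_mono_on {..<k} (\<lambda>i. i * k + w i)"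
    proof (rule strict_mono_onI)
      fix i j assume "i \<in> {..<k}" "j \<in> {..<k}" "i < j"
      then have "i * k + w i < Suc i * k" using less by simp
      also have "\<dots> \<le> j * k" using \<open>i < j\<close> by (intro mult_right_mono) auto
      finally show "i * k + w i < j * k + w j" by simp
    qed
    have "i * k + w i < k * k" if "i < k" for i
    proof -
      have "Suc i * k \<le> k * k" using that by (intro mult_right_mono) auto
      then show ?thesis using less[OF that] by simp
    qed
    then show "(\<lambda>i. i * k + w i) ` {..<k} \<subseteq> {..<k * k}" by auto
  qed
  \<comment> \<open>Two interlaced selections whose difference reproduces the prescribed signs \<open>s\<close>.\<close>
  define w w' where "w i = (if c i * s i = 1 then v i else u i)"
    and "w' i = (if c i * s i = 1 then u i else v i)" for i
  have "s i *\<^sub>R (x (i * k + v i) - x (i * k + u i)) = c i *\<^sub>R x (i * k + w i) - c i *\<^sub>R x (i * k + w' i)"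
    if "i < k" for i
    using signs_mem[OF c that] signs_mem[OF s that] by (auto simp: w_def w'_def algebra_simps)
  then have "(\<Sum>i<k. s i *\<^sub>R (x (i * k + v i) - x (i * k + u i)))
      = (\<Sum>i<k. c i *\<^sub>R x (i * k + w i)) - (\<Sum>i<k. c i *\<^sub>R x (i * k + w' i))"
    by (simp add: sum_subtractf)
  also have "norm \<dots> \<le> M + M"
    by (rule norm_triangle_le_diff, rule add_mono; rule block) (auto simp: w_def w'_def uv)
  finally show ?thesis by simp
qed

text \<open>A bound on all signed sums replaces the Rademacher average of cotype 2; \<open>C\<close>
  is the square of the usual constant.\<close>

definition orlicz_property :: "'z::real_normed_vector itself \<Rightarrow> real \<Rightarrow> bool" where
  "orlicz_property Z C \<longleftrightarrow> (\<forall>n (z :: nat \<Rightarrow> 'z) B.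
     (\<forall>s\<in>signs n. norm (\<Sum>i<n. s i *\<^sub>R z i) \<le> B) \<longrightarrow> (\<Sum>i<n. (norm (z i))\<^sup>2) \<le> C * B\<^sup>2)"

lemma cotype2_fn_growth:
  assumes C: "0 < C" and orl: "orlicz_property TYPE('z::real_normed_vector) C" and a: "0 < a"
  shows "\<exists>K. \<forall>n. cotype2_fn TYPE('z) n \<le> K * real n powr (2 * a)"
proof (rule ccontr)
  let ?F = "cotype2_fn TYPE('z)"
  assume "\<not> ?thesis"
  then have unb: "\<exists>n. K * real n powr (2 * a) < ?F n" for K by (meson not_le)
  \<comment> \<open>This makes \<open>\<kappa> > 64 + 256 * C\<close>: the 64 yields a separated
    pair in every block, and \<open>256 * C\<close> the final contradiction. Adding 2 secures
    \<open>k \<ge> 2\<close>.\<close>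
  define k where "k = nat \<lceil>(64 + 256 * C) powr (1 / (2 * a))\<rceil> + 2"
  have k: "2 \<le> k" by (simp add: k_def)
  define \<kappa> where "\<kappa> = real k powr (2 * a)"
  have "(64 + 256 * C) powr (1 / (2 * a)) < real k"
    unfolding k_def by linarith
  then have "((64 + 256 * C) powr (1 / (2 * a))) powr (2 * a) < \<kappa>"
    unfolding \<kappa>_def using a by (intro powr_less_mono2) auto
  then have \<kappa>: "64 + 256 * C < \<kappa>" using C a by (simp add: powr_powr)
  \<comment> \<open>The Ramsey number is taken for \<open>k * k\<close> vectors, that is, for
    \<open>k\<close> blocks of length \<open>k\<close>.\<close>
  obtain N :: nat where N: "\<forall>(J :: nat set) (x :: nat \<Rightarrow> 'z) M.
      finite J \<and> N \<le> card J \<and> (\<forall>A\<subseteq>J. card A = k \<longrightarrow>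
         (\<exists>\<epsilon>. (\<forall>a\<in>A. \<epsilon> a \<in> {-1, 1::real}) \<and> norm (\<Sum>a\<in>A. \<epsilon> a *\<^sub>R x a) \<le> M))
      \<longrightarrow> sign_homogeneous k (k * k) J x M"
    by (rule exE[OF sign_selection])
  \<comment> \<open>The first property keeps the discarded weight small; the second ensures that
    more than \<open>2 * N\<close> of the weight remains.\<close>
  obtain P where P: "\<kappa> * ?F P < ?F (k * P)" "8 * real N < ?F (k * P)"
  proof -
    have "mono ?F" by (intro monoI cotype2_fn_mono)
    then show thesis
      using growth_dichotomy[OF _ cotype2_fn_zero cotype2_fn_nonneg _ k unb, of "8 * real N"] a that
      unfolding \<kappa>_def by auto
  qed
  have half: "?F (k * P) / 2 < ?F (k * P)" using P(2) by linarith
  obtain m and x :: "nat \<Rightarrow> 'z" where x: "rad2 m x \<le> 1" "card {i. i < m \<and> x i \<noteq> 0} \<le> k * P"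
    "?F (k * P) / 2 < (\<Sum>i<m. (norm (x i))\<^sup>2)"
    by (rule cotype2_fn_attain[OF half])
  define I where "I = {i. i < m \<and> x i \<noteq> 0}"
  \<comment> \<open>With this choice the discarded weight is at most
    \<open>\<kappa> * ?F P / 4 < ?F (k * P) / 4\<close>, less than half of the weight of the nearly
    extremal family.\<close>
  define \<mu> where "\<mu> = 4 / \<kappa>"
  have \<mu>: "0 < \<mu>" using \<kappa> C by (simp add: \<mu>_def)
  obtain J where J: "J \<subseteq> I"
    "\<And>A. A \<subseteq> J \<Longrightarrow> card A = k \<Longrightarrow> rad2 m (zero_outside A x) \<le> \<mu> * (\<Sum>i\<in>A. (norm (x i))\<^sup>2)"
    "(\<Sum>i\<in>I - J. (norm (x i))\<^sup>2) \<le> ?F P / \<mu>"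
    using exhaustion[of k \<mu> I m P x] k \<mu> x by (auto simp: I_def)
  have Im: "I \<subseteq> {..<m}" and finI: "finite I" by (auto simp: I_def)
  have finJ: "finite J" using J(1) finI finite_subset by blast
  have "?F P / \<mu> < ?F (k * P) / 4"
    using P(1) \<kappa> C by (simp add: \<mu>_def field_simps)
  moreover have "(\<Sum>i<m. (norm (x i))\<^sup>2) = (\<Sum>i\<in>I - J. (norm (x i))\<^sup>2) + (\<Sum>i\<in>J. (norm (x i))\<^sup>2)"
    unfolding sum_norm_support[of x] I_def[symmetric] by (rule sum.subset_diff[OF J(1) finI])
  ultimately have "2 * real N < (\<Sum>i\<in>J. (norm (x i))\<^sup>2)"
    using J(3) x(3) P(2) by linarith
  \<comment> \<open>If every dyadic level had at most \<open>N\<close> vectors, the weight would be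
    at most \<open>2 * N\<close>, since squared norms are at most 1.\<close>
  moreover have "(\<Sum>i\<in>J. (norm (x i))\<^sup>2) \<le> 2 * real N * 1"
    if "\<And>t. card {i\<in>J. t / 2 < (norm (x i))\<^sup>2 \<and> (norm (x i))\<^sup>2 \<le> t} \<le> N"
  proof (rule level_pigeonhole[OF finJ])
    fix i assume "i \<in> J"
    then have i: "i < m" "x i \<noteq> 0" using J(1) by (auto simp: I_def)
    show "0 < (norm (x i))\<^sup>2" using i by simp
    show "(norm (x i))\<^sup>2 \<le> 1" using norm_le_rad2[OF i(1), of x] x(1) by simp
  qed (use that in auto)
  ultimately have "\<exists>t. \<not> card {i\<in>J. t / 2 < (norm (x i))\<^sup>2 \<and> (norm (x i))\<^sup>2 \<le> t} \<le> N"
    by fastforce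
  then obtain t where t: "N < card {i\<in>J. t / 2 < (norm (x i))\<^sup>2 \<and> (norm (x i))\<^sup>2 \<le> t}"
    by (auto simp: not_le)
  define L where "L = {i\<in>J. t / 2 < (norm (x i))\<^sup>2 \<and> (norm (x i))\<^sup>2 \<le> t}"
  have cardL: "N < card L" using t unfolding L_def .
  then have "L \<noteq> {}" by auto
  then obtain i0 where "i0 \<in> L" by blast
  then have t0: "0 < t" using zero_le_power2[of "norm (x i0)"] unfolding L_def by (auto simp: field_simps)
  define \<tau> where "\<tau> = sqrt t"
  have \<tau>: "0 < \<tau>" "\<tau>\<^sup>2 = t" using t0 by (auto simp: \<tau>_def)
  \<comment> \<open>Squared norms in \<open>L\<close> are at most \<open>t\<close>, so every
    \<open>k\<close>-subset of \<open>L\<close> has \<open>rad2\<close> at most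
    \<open>\<mu> * (k * t)\<close>.\<close>
  define M where "M = sqrt (\<mu> * (real k * t))"
  have M: "0 \<le> M" "M\<^sup>2 = \<mu> * (real k * t)" using \<mu> t0 by (auto simp: M_def)
  have radL: "rad2 m (zero_outside A x) \<le> M\<^sup>2" if A: "A \<subseteq> L" "card A = k" for A
  proof -
    have "rad2 m (zero_outside A x) \<le> \<mu> * (\<Sum>i\<in>A. (norm (x i))\<^sup>2)"
      by (rule J(2)) (use A in \<open>auto simp: L_def\<close>)
    also have "(\<Sum>i\<in>A. (norm (x i))\<^sup>2) \<le> real (card A) * t"
      by (rule sum_bounded_above) (use A in \<open>auto simp: L_def\<close>)
    finally show ?thesis using A \<mu> M by simp
  qed
  have Lm: "L \<subseteq> {..<m}" using J(1) Im by (auto simp: L_def)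
  have "sign_homogeneous k (k * k) L x M"
  proof (rule N[rule_format], intro conjI allI impI)
    show "finite L" using Lm finite_subset by blast
    show "N \<le> card L" using cardL by simp
    fix A assume A: "A \<subseteq> L" "card A = k"
    obtain \<epsilon> where \<epsilon>: "\<epsilon> \<in> signs m" "norm (\<Sum>i<m. \<epsilon> i *\<^sub>R zero_outside A x i) \<le> M"
      by (rule rad2_attained[OF radL[OF A] M(1)])
    have Am: "A \<subseteq> {..<m}" using A Lm by simp
    have "\<epsilon> a \<in> {-1, 1}" if "a \<in> A" for a
      using signs_mem[OF \<epsilon>(1), of a] Am that by auto
    then show "\<exists>\<epsilon>. (\<forall>a\<in>A. \<epsilon> a \<in> {-1, 1::real}) \<and> norm (\<Sum>a\<in>A. \<epsilon> a *\<^sub>R x a) \<le> M"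
      using \<epsilon>(2) unfolding sum_scaleR_zero_outside[OF Am] by (intro exI[of _ \<epsilon>]) simp
  qed
  then obtain h c where hL: "h ` {..<k * k} \<subseteq> L" and inj: "inj_on h {..<k * k}" and c: "c \<in> signs k"
    and sel: "\<forall>p. strict_mono_on {..<k} p \<longrightarrow> p ` {..<k} \<subseteq> {..<k * k} \<longrightarrow>
          norm (\<Sum>i<k. c i *\<^sub>R x (h (p i))) \<le> M"
    by (rule sign_homogeneousE)
  \<comment> \<open>Each block of the enumeration gives a \<open>k\<close>-subset of
    \<open>L\<close>, whose \<open>rad2\<close> is below \<open>k * (\<tau> / 4)\<^sup>2\<close>
    because \<open>\<mu> = 4 / \<kappa> < 1 / 16\<close>.\<close>
  have pair: "\<exists>u<k. \<exists>v<k. \<tau> / 4 < norm (x (h (i * k + v)) - x (h (i * k + u)))" if i: "i < k" for i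
  proof -
    have "i * k + u < k * k" if "u < k" for u
    proof -
      have "i * k + u < Suc i * k" using that by simp
      also have "\<dots> \<le> k * k" using i by (intro mult_right_mono) auto
      finally show ?thesis .
    qed
    then have sub: "(\<lambda>u. i * k + u) ` {..<k} \<subseteq> {..<k * k}" by auto
    define g where "g u = h (i * k + u)" for u
    have ginj: "inj_on g {..<k}"
    proof (rule inj_onI)
      fix u v assume "u \<in> {..<k}" "v \<in> {..<k}" "g u = g v"
      then show "u = v" using inj_onD[OF inj, of "i * k + u" "i * k + v"] sub by (auto simp: g_def)
    qed
    have gL: "g ` {..<k} \<subseteq> L" using hL sub by (auto simp: g_def)
    have "\<exists>u<k. \<exists>v<k. \<tau> / 4 < norm (x (g v) - x (g u))"
    proof (rule separated_pair_in_block[OF ginj])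
      show "g ` {..<k} \<subseteq> {..<m}" using gL Lm by simp
      show "\<tau> / 2 \<le> norm (x (g u))" if "u < k" for u
      proof (rule power2_le_imp_le)
        have "g u \<in> L" using gL that by auto
        then show "(\<tau> / 2)\<^sup>2 \<le> (norm (x (g u)))\<^sup>2"
          using t0 by (simp add: power_divide \<tau> L_def)
      qed simp
      have "card (g ` {..<k}) = k" using ginj by (simp add: card_image)
      then have "rad2 m (zero_outside (g ` {..<k}) x) \<le> \<mu> * (real k * t)"
        using radL[OF gL] M by simp
      also have "\<dots> < real k * (\<tau> / 4)\<^sup>2"
        using \<kappa> C k t0 by (simp add: \<mu>_def power_divide \<tau> field_simps)
      finally show "rad2 m (zero_outside (g ` {..<k}) x) < real k * (\<tau> / 4)\<^sup>2" .
    qed (use k \<tau> in auto)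
    then show ?thesis by (simp add: g_def)
  qed
  have "\<forall>i\<in>{..<k}. \<exists>uv. fst uv < k \<and> snd uv < k \<and> \<tau> / 4 < norm (x (h (i * k + snd uv)) - x (h (i * k + fst uv)))"
    using pair by fastforce
  then obtain uv where uv: "\<And>i. i < k \<Longrightarrow> fst (uv i) < k \<and> snd (uv i) < k \<and>
      \<tau> / 4 < norm (x (h (i * k + snd (uv i))) - x (h (i * k + fst (uv i))))"
    by (metis lessThan_iff)
  define d where "d i = x (h (i * k + snd (uv i))) - x (h (i * k + fst (uv i)))" for i
  have "\<forall>s\<in>signs k. norm (\<Sum>i<k. s i *\<^sub>R d i) \<le> 2 * M"
  proof
    fix s assume s: "s \<in> signs k"
    show "norm (\<Sum>i<k. s i *\<^sub>R d i) \<le> 2 * M"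
      unfolding d_def
      by (rule sign_sum_of_differences[OF c s, where x = "\<lambda>j. x (h j)"]) (use uv sel in simp_all)
  qed
  then have "(\<Sum>i<k. (norm (d i))\<^sup>2) \<le> C * (2 * M)\<^sup>2"
    using orl unfolding orlicz_property_def by blast
  moreover have "real k * (\<tau> / 4)\<^sup>2 \<le> (\<Sum>i<k. (norm (d i))\<^sup>2)"
  proof -
    have "(\<tau> / 4)\<^sup>2 \<le> (norm (d i))\<^sup>2" if "i < k" for i
      using uv[OF that] \<tau> by (intro power_mono) (auto simp: d_def)
    then show ?thesis
      using sum_bounded_below[of "{..<k}" "(\<tau> / 4)\<^sup>2" "\<lambda>i. (norm (d i))\<^sup>2"] by simp
  qed
  ultimately have "real k * (\<tau> / 4)\<^sup>2 \<le> C * (2 * M)\<^sup>2" by simp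
  \<comment> \<open>The constant is \<open>16 * 4 * 4\<close>, from
    \<open>(\<tau> / 4)\<^sup>2\<close>, \<open>(2 * M)\<^sup>2\<close> and
    \<open>\<mu> = 4 / \<kappa>\<close>.\<close>
  then have "real k * t * \<kappa> \<le> real k * t * (256 * C)"
    using \<kappa> C by (simp add: power_divide power_mult_distrib \<tau> M \<mu>_def field_simps)
  then have "\<kappa> \<le> 256 * C" using k t0 by simp
  then show False using \<kappa> by simp
qed

theorem cotype_index_eq_2_if_orlicz:
  assumes C: "0 < C" and orl: "orlicz_property TYPE('z::real_normed_vector) C"
  shows "cotype_index TYPE('z) = 2"
proof -
  have cot: "has_cotype TYPE('z) (ereal q)" if q: "2 < q" for q
  proof -
    \<comment> \<open>With this choice \<open>2 * a\<close> is half of the gap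
      \<open>1 - 2 / q\<close>.\<close>
    define a where "a = (1 - 2 / q) / 4"
    have a: "0 < a" "2 / q < 1 - 2 * a" using q by (auto simp: a_def field_simps)
    then show ?thesis
      using cotype2_fn_growth[OF C orl, of a] has_cotype_if_cotype2_fn_le[OF q a] by blast
  qed
  have "cotype_index TYPE('z) \<le> 2"
  proof (rule ereal_le_epsilon2)
    fix e :: real assume e: "0 < e"
    have "cotype_index TYPE('z) \<le> ereal (2 + e)"
      unfolding cotype_index_def by (rule Inf_lower) (use cot[of "2 + e"] e in auto)
    then show "cotype_index TYPE('z) \<le> 2 + ereal e" by simp
  qed
  moreover have "2 \<le> cotype_index TYPE('z)"
    unfolding cotype_index_def by (rule Inf_greatest) auto
  ultimately show ?thesis by simp
qed


section \<open>Multiple summing forms\<close>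

lift_definition ell1_unit :: "nat \<Rightarrow> 'k::real_normed_field ell1" is "\<lambda>p n. if n = p then 1 else 0"
proof -
  fix p :: nat
  show "summable (\<lambda>n. norm (if n = p then 1 else 0 :: 'k))"
    by (rule summable_finite[of "{p}"]) auto
qed

lemma norm_ell1_unit: "norm (ell1_unit p :: 'k::real_normed_field ell1) = 1"
proof -
  have "norm (ell1_unit p :: 'k ell1) = (\<Sum>n. norm (if n = p then 1 else 0 :: 'k))"
    by transfer simp
  also have "\<dots> = (\<Sum>n\<in>{p}. norm (if n = p then 1 else 0 :: 'k))"
    by (rule suminf_finite) auto
  finally show ?thesis by simp
qed

lemma norm_ell1_nth_le: "norm (ell1_nth a n) \<le> norm a"
proof -
  have "norm (ell1_nth a n) = (\<Sum>i\<in>{n}. norm (ell1_nth a i))" by simp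
  also have "\<dots> \<le> norm a"
    unfolding norm_ell1.rep_eq by (rule sum_le_suminf[OF summable_ell1]) auto
  finally show ?thesis .
qed

lemma bounded_linear_ell1_nth: "bounded_linear (\<lambda>a. ell1_nth a n)"
  by (rule bounded_linear_intro[of _ 1])
     (auto simp: plus_ell1.rep_eq scaleR_ell1.rep_eq norm_ell1_nth_le)

lemma dual_ballD:
  assumes "f \<in> dual_ball s"
  shows "linear f" "norm (f x) \<le> norm x"
proof -
  have f: "bounded_linear f" "onorm f \<le> 1" using assms by (auto simp: dual_ball_def)
  show "linear f" using f bounded_linear.linear by blast
  have "norm (f x) \<le> onorm f * norm x" by (rule onorm[OF f(1)])
  also have "\<dots> \<le> 1 * norm x" by (intro mult_right_mono f) simp
  finally show "norm (f x) \<le> norm x" by simp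
qed

lemma enn_powr_one: "enn_powr a (1 / 1) = a"
  by (cases a) (auto simp: enn_powr_def)

lemma weak_norm_one_le:
  assumes "\<And>f. f \<in> dual_ball s \<Longrightarrow> (\<Sum>i<n. norm (f (x i))) \<le> K" "\<And>i. n \<le> i \<Longrightarrow> x i = 0"
  shows "weak_norm s 1 x \<le> ennreal K"
  unfolding weak_norm_def
proof (rule SUP_least)
  fix f assume f: "f \<in> dual_ball s"
  have "f 0 = 0" using dual_ballD(1)[OF f] linear_0 by blast
  then have "(\<Sum>i. ennreal (norm (f (x i)) powr 1)) = (\<Sum>i<n. ennreal (norm (f (x i)) powr 1))"
    using assms(2) by (intro suminf_finite) (auto simp: not_less)
  also have "\<dots> = ennreal (\<Sum>i<n. norm (f (x i)))"
    by (simp add: sum_ennreal)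
  also have "\<dots> \<le> ennreal K" by (intro ennreal_leI assms f)
  finally show "enn_powr (\<Sum>i. ennreal (norm (f (x i)) powr 1)) (1 / 1) \<le> ennreal K"
    by (simp only: enn_powr_one)
qed

section \<open>The multilinear form attached to a sequence of functionals\<close>

definition ell1_pairing :: "(nat \<Rightarrow> 'z \<Rightarrow> 'k) \<Rightarrow> 'k::{real_normed_field,banach} ell1 \<Rightarrow> 'z \<Rightarrow> 'k" where
  "ell1_pairing \<psi> a z = (\<Sum>p. ell1_nth a p * \<psi> p z)"

text \<open>Only slot \<open>k\<^sub>0\<close> is paired with \<open>'z\<close>; the other
  sequence-space slots enter through their coordinate 0, which extends the bilinear form to
  \<open>m + 1\<close> arguments.\<close>

definition pairing_map ::
  "(nat \<Rightarrow> 'z \<Rightarrow> 'k) \<Rightarrow> 'm::finite \<Rightarrow> ('m \<Rightarrow> 'k::{real_normed_field,banach} ell1) \<times> 'z \<Rightarrow> 'k" where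
  "pairing_map \<psi> k\<^sub>0 = (\<lambda>(x, z). (\<Prod>k\<in>UNIV - {k\<^sub>0}. ell1_nth (x k) 0) * ell1_pairing \<psi> (x k\<^sub>0) z)"

context
  fixes s :: "'k::{real_normed_field,banach} \<Rightarrow> 'z::real_normed_vector \<Rightarrow> 'z" and \<psi> :: "nat \<Rightarrow> 'z \<Rightarrow> 'k"
  assumes s: "normed_space_over s"
    and lin: "\<And>p. Vector_Spaces.linear s (*) (\<psi> p)" and le: "\<And>p z. norm (\<psi> p z) \<le> norm z"
begin

interpretation normed_space_over s by (rule s)

lemma pairing_summable:
  "summable (\<lambda>p. norm (ell1_nth a p * \<psi> p z))" "summable (\<lambda>p. ell1_nth a p * \<psi> p z)"
proof -
  show "summable (\<lambda>p. norm (ell1_nth a p * \<psi> p z))"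
    by (rule summable_comparison_test'[OF summable_mult2[OF summable_ell1[of a], of "norm z"], of 0])
       (simp add: norm_mult mult_left_mono le)
  then show "summable (\<lambda>p. ell1_nth a p * \<psi> p z)" by (rule summable_norm_cancel)
qed

lemma pairing_add_left: "ell1_pairing \<psi> (a + b) z = ell1_pairing \<psi> a z + ell1_pairing \<psi> b z"
  by (simp add: ell1_pairing_def plus_ell1.rep_eq distrib_right suminf_add pairing_summable)

lemma pairing_scale_left: "ell1_pairing \<psi> (scale_ell1 c a) z = c * ell1_pairing \<psi> a z"
  by (simp add: ell1_pairing_def scale_ell1.rep_eq mult.assoc suminf_mult pairing_summable)

lemma pairing_add_right: "ell1_pairing \<psi> a (z + w) = ell1_pairing \<psi> a z + ell1_pairing \<psi> a w"
proof -
  have "\<psi> p (z + w) = \<psi> p z + \<psi> p w" for p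
    using lin[of p] by (simp add: Vector_Spaces.linear_iff)
  then show ?thesis
    by (simp add: ell1_pairing_def distrib_left suminf_add pairing_summable)
qed

lemma pairing_scale_right: "ell1_pairing \<psi> a (s c z) = c * ell1_pairing \<psi> a z"
proof -
  have "\<psi> p (s c z) = c * \<psi> p z" for p
    using lin[of p] by (simp add: Vector_Spaces.linear_iff)
  then show ?thesis
    by (simp add: ell1_pairing_def mult.left_commute[of _ c] suminf_mult pairing_summable)
qed

lemma pairing_bounded_bilinear: "bounded_bilinear (ell1_pairing \<psi>)"
proof
  show "\<exists>K. \<forall>a z. norm (ell1_pairing \<psi> a z) \<le> norm a * norm z * K"
  proof (intro exI[of _ 1] allI)
    fix a :: "'k ell1" and z :: 'z
    have "norm (ell1_pairing \<psi> a z) \<le> (\<Sum>p. norm (ell1_nth a p * \<psi> p z))"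
      unfolding ell1_pairing_def by (rule summable_norm[OF pairing_summable(1)])
    also have "\<dots> \<le> (\<Sum>p. norm (ell1_nth a p) * norm z)"
      by (intro suminf_le pairing_summable summable_mult2 summable_ell1)
         (simp add: norm_mult mult_left_mono le)
    also have "\<dots> = norm a * norm z"
      by (simp add: norm_ell1.rep_eq suminf_mult2 summable_ell1)
    finally show "norm (ell1_pairing \<psi> a z) \<le> norm a * norm z * 1" by simp
  qed
  fix r :: real and a :: "'k ell1" and z :: 'z
  have "scale_ell1 (of_real r) a = r *\<^sub>R a"
    using normed_space_over_scale_ell1 by (rule normed_space_over.scale_of_real)
  then show "ell1_pairing \<psi> (r *\<^sub>R a) z = r *\<^sub>R ell1_pairing \<psi> a z"
    using pairing_scale_left[of "of_real r" a z] by (simp add: scaleR_conv_of_real)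
  show "ell1_pairing \<psi> a (r *\<^sub>R z) = r *\<^sub>R ell1_pairing \<psi> a z"
    using pairing_scale_right[of a "of_real r" z] by (simp add: scale_of_real scaleR_conv_of_real)
qed (rule pairing_add_left pairing_add_right)+

lemma pairing_unit: "ell1_pairing \<psi> (ell1_unit p) z = \<psi> p z"
proof -
  have "ell1_pairing \<psi> (ell1_unit p) z = (\<Sum>n\<in>{p}. (if n = p then 1 else 0) * \<psi> n z)"
    unfolding ell1_pairing_def ell1_unit.rep_eq by (rule suminf_finite) auto
  then show ?thesis by simp
qed

lemma pairing_map_multilinear: "pairing_map \<psi> k\<^sub>0 \<in> multilinear_maps scale_ell1 s (*)"
proof -
  have vs: "vector_space (scale_ell1 :: 'k \<Rightarrow> _)" "vector_space s" "vector_space ((*) :: 'k \<Rightarrow> _)"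
    using normed_space_over_scale_ell1 s normed_space_over_mult
    unfolding normed_space_over_def by blast+
  have "Vector_Spaces.linear scale_ell1 (*) (\<lambda>u. pairing_map \<psi> k\<^sub>0 (x(k := u), z))" for x k z
  proof (cases "k = k\<^sub>0")
    case True
    define c where "c = (\<Prod>k\<in>UNIV - {k\<^sub>0}. ell1_nth (x k) 0)"
    have "(\<Prod>k\<in>UNIV - {k\<^sub>0}. ell1_nth ((x(k\<^sub>0 := u)) k) 0) = c" for u
      unfolding c_def by (rule prod.cong) auto
    then have "pairing_map \<psi> k\<^sub>0 (x(k := u), z) = c * ell1_pairing \<psi> u z" for u
      by (simp add: pairing_map_def True)
    then show ?thesis
      using vs by (simp add: Vector_Spaces.linear_iff pairing_add_left pairing_scale_left algebra_simps)
  next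
    case False
    define c where "c = (\<Prod>l\<in>UNIV - {k\<^sub>0} - {k}. ell1_nth (x l) 0) * ell1_pairing \<psi> (x k\<^sub>0) z"
    have "(\<Prod>l\<in>UNIV - {k\<^sub>0}. ell1_nth ((x(k := u)) l) 0)
        = ell1_nth u 0 * (\<Prod>l\<in>UNIV - {k\<^sub>0} - {k}. ell1_nth (x l) 0)" for u
    proof (subst prod.remove[of _ k])
      show "ell1_nth ((x(k := u)) k) 0 * (\<Prod>l\<in>UNIV - {k\<^sub>0} - {k}. ell1_nth ((x(k := u)) l) 0)
        = ell1_nth u 0 * (\<Prod>l\<in>UNIV - {k\<^sub>0} - {k}. ell1_nth (x l) 0)"
        by (intro arg_cong2[where f = "(*)"] prod.cong) auto
    qed (use False in auto)
    then have "pairing_map \<psi> k\<^sub>0 (x(k := u), z) = ell1_nth u 0 * c" for u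
      using False by (simp add: pairing_map_def c_def mult.assoc)
    then show ?thesis
      using vs by (simp add: Vector_Spaces.linear_iff plus_ell1.rep_eq scale_ell1.rep_eq algebra_simps)
  qed
  moreover have "Vector_Spaces.linear s (*) (\<lambda>z. pairing_map \<psi> k\<^sub>0 (x, z))" for x
    using vs by (simp add: Vector_Spaces.linear_iff pairing_map_def pairing_add_right
        pairing_scale_right algebra_simps)
  moreover have "continuous_on UNIV (pairing_map \<psi> k\<^sub>0)"
  proof -
    have coord: "continuous_on UNIV (\<lambda>xz :: ('m \<Rightarrow> 'k ell1) \<times> 'z. fst xz k)" for k
      by (rule continuous_on_compose2[where g = "\<lambda>x. x k" and f = fst and t = UNIV])
         (auto intro: continuous_on_fst continuous_on_id)
    show ?thesis
      unfolding pairing_map_def case_prod_unfold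
      by (intro continuous_on_mult continuous_on_prod bounded_bilinear.continuous_on[OF pairing_bounded_bilinear]
          bounded_linear.continuous_on[OF bounded_linear_ell1_nth] coord continuous_on_snd continuous_on_id)
  qed
  ultimately show ?thesis by (simp add: multilinear_maps_def)
qed


lemma pairing_finite_sum:
  "ell1_pairing \<psi> (\<Sum>j<n. r j *\<^sub>R ell1_unit (e j)) z = (\<Sum>j<n. r j *\<^sub>R \<psi> (e j) z)"
  by (simp add: bounded_bilinear.sum_left[OF pairing_bounded_bilinear]
      bounded_bilinear.scaleR_left[OF pairing_bounded_bilinear] pairing_unit)

end

text \<open>For \<open>f\<close> in the dual ball the values \<open>t j\<close> on unit vectors are
  at most 1 in norm. The sum of \<open>norm (f (x i))\<close> is the mean of the signed sums of
  \<open>c j *\<^sub>R t j\<close>, which Cauchy-Schwarz and orthogonality of the signs bound by the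
  Euclidean norm of \<open>c\<close>.\<close>

lemma weak_norm_sign_average_le:
  fixes c :: "nat \<Rightarrow> real" and b :: "nat \<Rightarrow> nat \<Rightarrow> real" and e :: "nat \<Rightarrow> nat"
  assumes b: "bij_betw b {..<2 ^ n} (signs n)"
  defines "x \<equiv> \<lambda>i. if i < 2 ^ n then \<Sum>j<n. (c j * b i j / 2 ^ n) *\<^sub>R (ell1_unit (e j) :: 'k::{real_normed_field,real_inner} ell1) else 0"
  shows "weak_norm scale_ell1 1 x \<le> ennreal (sqrt (\<Sum>j<n. (c j)\<^sup>2))"
proof (rule weak_norm_one_le)
  fix f :: "'k ell1 \<Rightarrow> 'k" assume f: "f \<in> dual_ball scale_ell1"
  have lin: "linear f" by (rule dual_ballD(1)[OF f])
  define t where "t j = f (ell1_unit (e j))" for j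
  have t: "norm (t j) \<le> 1" for j
    using dual_ballD(2)[OF f, of "ell1_unit (e j)"] by (simp add: t_def norm_ell1_unit)
  have "norm (f (x i)) = norm (\<Sum>j<n. b i j *\<^sub>R c j *\<^sub>R t j) / 2 ^ n" if "i < 2 ^ n" for i
  proof -
    have "f (x i) = (\<Sum>j<n. (c j * b i j / 2 ^ n) *\<^sub>R t j)"
      using that by (simp add: x_def t_def linear_sum[OF lin] linear_scale[OF lin])
    also have "\<dots> = (1 / 2 ^ n) *\<^sub>R (\<Sum>j<n. b i j *\<^sub>R c j *\<^sub>R t j)"
      by (simp add: scaleR_sum_right mult.commute)
    finally show ?thesis by simp
  qed
  then have "(\<Sum>i<2 ^ n. norm (f (x i))) = (\<Sum>i<2 ^ n. norm (\<Sum>j<n. b i j *\<^sub>R c j *\<^sub>R t j) / 2 ^ n)"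
    by simp
  also have "\<dots> = (\<Sum>\<epsilon>\<in>signs n. norm (\<Sum>j<n. \<epsilon> j *\<^sub>R c j *\<^sub>R t j)) / 2 ^ n"
    unfolding sum_divide_distrib[symmetric]
    by (intro arg_cong2[where f = "(/)"] sum.reindex_bij_betw[OF b] refl)
  also have "\<dots> \<le> sqrt (rad2 n (\<lambda>j. c j *\<^sub>R t j))"
    by (rule mean_norm_le_sqrt_rad2)
  also have "\<dots> \<le> sqrt (\<Sum>j<n. (c j)\<^sup>2)"
  proof (intro real_sqrt_le_mono)
    have "(norm (c j *\<^sub>R t j))\<^sup>2 \<le> (c j)\<^sup>2" for j
    proof -
      have "norm (c j *\<^sub>R t j) \<le> \<bar>c j\<bar>" using t[of j] by (simp add: mult_left_le)
      then have "(norm (c j *\<^sub>R t j))\<^sup>2 \<le> \<bar>c j\<bar>\<^sup>2" by (intro power_mono) auto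
      then show ?thesis by simp
    qed
    then show "rad2 n (\<lambda>j. c j *\<^sub>R t j) \<le> (\<Sum>j<n. (c j)\<^sup>2)"
      by (simp only: rad2_inner sum_mono)
  qed
  finally show "(\<Sum>i<2 ^ n. norm (f (x i))) \<le> sqrt (\<Sum>j<n. (c j)\<^sup>2)" .
qed (simp add: x_def)

text \<open>The scalar inequality enters as the hypothesis \<open>signs\<close>, so that both scalar
  fields share the argument; its factor 2 is the cost of splitting complex numbers into real and
  imaginary parts.\<close>

lemma weak_norm_signs_le:
  fixes s :: "'k::real_normed_field \<Rightarrow> 'z::real_normed_vector \<Rightarrow> 'z"
  assumes signs: "\<And>n (a :: nat \<Rightarrow> 'k) B. (\<And>\<delta>. \<delta> \<in> signs n \<Longrightarrow> norm (\<Sum>i<n. \<delta> i *\<^sub>R a i) \<le> B) \<Longrightarrow> (\<Sum>i<n. norm (a i)) \<le> 2 * B"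
    and z: "\<And>\<delta>. \<delta> \<in> signs n \<Longrightarrow> norm (\<Sum>i<n. \<delta> i *\<^sub>R z i) \<le> B"
  shows "weak_norm s 1 (\<lambda>j. if j < n then z j else 0) \<le> ennreal (2 * B)"
proof (rule weak_norm_one_le)
  fix f :: "'z \<Rightarrow> 'k" assume f: "f \<in> dual_ball s"
  have lin: "linear f" by (rule dual_ballD(1)[OF f])
  have "(\<Sum>i<n. norm (f (z i))) \<le> 2 * B"
  proof (rule signs)
    fix \<delta> assume "\<delta> \<in> signs n"
    have "(\<Sum>i<n. \<delta> i *\<^sub>R f (z i)) = f (\<Sum>i<n. \<delta> i *\<^sub>R z i)"
      by (simp add: linear_sum[OF lin] linear_scale[OF lin])
    then show "norm (\<Sum>i<n. \<delta> i *\<^sub>R f (z i)) \<le> B"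
      using dual_ballD(2)[OF f, of "\<Sum>i<n. \<delta> i *\<^sub>R z i"] z[OF \<open>\<delta> \<in> signs n\<close>] by simp
  qed
  then show "(\<Sum>i<n. norm (f (if i < n then z i else 0))) \<le> 2 * B" by simp
qed simp

text \<open>The coefficients \<open>c j = norm (z j)\<close> make the tested sum at least
  \<open>S\<^sup>2\<close>, while the weak norms bound it by \<open>C * S * (2 * B)\<close>;
  cancelling \<open>S\<close> gives a bound with the constant of the form alone.\<close>

lemma sum_squares_le_if_summing:
  fixes s :: "'k::{real_normed_field,banach,real_inner} \<Rightarrow> 'z::real_normed_vector \<Rightarrow> 'z" and k\<^sub>0 :: "'m::finite"
  assumes s: "normed_space_over s"
    and lin: "\<And>p. Vector_Spaces.linear s (*) (\<psi> p)" and le: "\<And>p z. norm (\<psi> p z) \<le> norm z"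
    and signs: "\<And>n (a :: nat \<Rightarrow> 'k) B. (\<And>\<delta>. \<delta> \<in> signs n \<Longrightarrow> norm (\<Sum>i<n. \<delta> i *\<^sub>R a i) \<le> B) \<Longrightarrow> (\<Sum>i<n. norm (a i)) \<le> 2 * B"
    and C: "0 < C" and summing: "\<And>(x :: 'm \<Rightarrow> nat \<Rightarrow> 'k ell1) (z :: nat \<Rightarrow> 'z).
       enn_powr (\<Sum>\<^sub>\<infinity>(i, j)\<in>(UNIV :: (('m \<Rightarrow> nat) \<times> nat) set).
                   ennreal (norm (pairing_map \<psi> k\<^sub>0 (\<lambda>k. x k (i k), z j)) powr 1)) (1 / 1)
         \<le> ennreal C * (\<Prod>k\<in>UNIV. weak_norm scale_ell1 1 (x k)) * weak_norm s 1 z"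
    and z: "\<And>\<delta>. \<delta> \<in> signs n \<Longrightarrow> norm (\<Sum>i<n. \<delta> i *\<^sub>R z i) \<le> B"
    and norming: "\<And>j. j < n \<Longrightarrow> norm (\<psi> (e j) (z j)) = norm (z j)"
  shows "(\<Sum>j<n. (norm (z j))\<^sup>2) \<le> (2 * C * B)\<^sup>2"
proof -
  obtain b :: "nat \<Rightarrow> nat \<Rightarrow> real" where b: "bij_betw b {..<2 ^ n} (signs n)"
    using ex_bij_betw_nat_finite[OF finite_signs[of n]] by (auto simp: atLeast0LessThan card_signs)
  define c where "c j = norm (z j)" for j
  define S where "S = sqrt (\<Sum>j<n. (c j)\<^sup>2)"
  have S: "0 \<le> S" "S\<^sup>2 = (\<Sum>j<n. (c j)\<^sup>2)" by (auto simp: S_def sum_nonneg)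
  have B: "0 \<le> B"
  proof -
    obtain \<delta> where "\<delta> \<in> signs n" using signs_nonempty[of n] unfolding ex_in_conv[symmetric] ..
    then show ?thesis by (rule order_trans[OF norm_ge_zero z])
  qed
  define y :: "nat \<Rightarrow> 'k ell1" where
    "y = (\<lambda>i. if i < 2 ^ n then \<Sum>j<n. (c j * b i j / 2 ^ n) *\<^sub>R ell1_unit (e j) else 0)"
  \<comment> \<open>The other slots receive one unit vector followed by zeros: weak norm at most 1,
    and coordinate factor 1 at index 0.\<close>
  define x where "x k = (if k = k\<^sub>0 then y else (\<lambda>i. if i = 0 then ell1_unit 0 else 0))" for k
  define w where "w j = (if j < n then z j else 0)" for j
  \<comment> \<open>Pairs are embedded into the full index set by putting index 0 in all slots other
    than \<open>k\<^sub>0\<close>.\<close>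
  define \<iota> where "\<iota> ij = ((\<lambda>k::'m. if k = k\<^sub>0 then fst ij else 0), snd ij)" for ij :: "nat \<times> nat"
  define g where "g ij = ennreal (norm (pairing_map \<psi> k\<^sub>0 (\<lambda>k. x k (fst ij k), w (snd ij))) powr 1)" for ij :: "('m \<Rightarrow> nat) \<times> nat"
  let ?D = "{..<2 ^ n} \<times> {..<n} :: (nat \<times> nat) set"
  have inj: "inj_on \<iota> ?D"
    by (rule inj_onI) (auto simp: \<iota>_def prod_eq_iff dest: fun_cong[where x = k\<^sub>0])
  have g: "g (\<iota> (i, j)) = ennreal (norm (ell1_pairing \<psi> (y i) (z j)))" if "j < n" for i j
  proof -
    have "(\<Prod>k\<in>UNIV - {k\<^sub>0}. ell1_nth (x k (fst (\<iota> (i, j)) k)) 0) = 1"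
      by (rule prod.neutral) (auto simp: x_def \<iota>_def ell1_unit.rep_eq)
    then show ?thesis
      using that by (simp add: g_def pairing_map_def x_def \<iota>_def w_def)
  qed
  \<comment> \<open>By \<open>norm_le_mean\<close> the average over signs dominates its diagonal
    term \<open>l = j\<close>, which equals \<open>(c j)\<^sup>2\<close> by the choice of the
    functional.\<close>
  have "S\<^sup>2 \<le> (\<Sum>j<n. \<Sum>i<2 ^ n. norm (ell1_pairing \<psi> (y i) (z j)))"
    unfolding S(2)
  proof (rule sum_mono)
    fix j assume "j \<in> {..<n}"
    then have j: "j < n" by simp
    have "(c j)\<^sup>2 = norm (c j *\<^sub>R \<psi> (e j) (z j))"
      using norming[OF j] by (simp add: c_def power2_eq_square)
    also have "\<dots> \<le> (\<Sum>\<epsilon>\<in>signs n. norm (\<Sum>l<n. \<epsilon> l *\<^sub>R c l *\<^sub>R \<psi> (e l) (z j))) / 2 ^ n"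
      by (rule norm_le_mean[OF j, of "\<lambda>l. c l *\<^sub>R \<psi> (e l) (z j)"])
    also have "\<dots> = (\<Sum>i<2 ^ n. norm (\<Sum>l<n. b i l *\<^sub>R c l *\<^sub>R \<psi> (e l) (z j))) / 2 ^ n"
      by (intro arg_cong2[where f = "(/)"] sum.reindex_bij_betw[OF b, symmetric] refl)
    also have "\<dots> = (\<Sum>i<2 ^ n. norm (ell1_pairing \<psi> (y i) (z j)))"
      unfolding sum_divide_distrib
    proof (rule sum.cong[OF refl])
      fix i :: nat assume "i \<in> {..<2 ^ n}"
      then have "ell1_pairing \<psi> (y i) (z j) = (\<Sum>l<n. (c l * b i l / 2 ^ n) *\<^sub>R \<psi> (e l) (z j))"
        by (simp add: y_def pairing_finite_sum[OF s lin le])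
      also have "\<dots> = (1 / 2 ^ n) *\<^sub>R (\<Sum>l<n. b i l *\<^sub>R c l *\<^sub>R \<psi> (e l) (z j))"
        by (simp add: scaleR_sum_right mult.commute)
      finally show "norm (\<Sum>l<n. b i l *\<^sub>R c l *\<^sub>R \<psi> (e l) (z j)) / 2 ^ n = norm (ell1_pairing \<psi> (y i) (z j))"
        by simp
    qed
    finally show "(c j)\<^sup>2 \<le> (\<Sum>i<2 ^ n. norm (ell1_pairing \<psi> (y i) (z j)))" .
  qed
  also have "\<dots> = (\<Sum>(i, j)\<in>?D. norm (ell1_pairing \<psi> (y i) (z j)))"
    by (subst sum.swap) (simp add: sum.cartesian_product)
  finally have "ennreal (S\<^sup>2) \<le> (\<Sum>(i, j)\<in>?D. ennreal (norm (ell1_pairing \<psi> (y i) (z j))))"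
    by (simp add: case_prod_unfold sum_ennreal ennreal_leI)
  also have "\<dots> = (\<Sum>ij\<in>?D. g (\<iota> ij))"
    by (rule sum.cong) (auto simp: g)
  also have "\<dots> = sum g (\<iota> ` ?D)"
    by (simp add: sum.reindex[OF inj])
  also have "\<dots> \<le> infsum g UNIV"
    unfolding nonneg_infsum_complete[of UNIV g, OF zero_le] by (rule SUP_upper) simp
  also have "\<dots> \<le> ennreal C * (\<Prod>k\<in>UNIV. weak_norm scale_ell1 1 (x k)) * weak_norm s 1 w"
    using summing[of x w] unfolding enn_powr_one by (simp add: g_def[abs_def] case_prod_unfold)
  also have "\<dots> \<le> ennreal C * (\<Prod>k\<in>UNIV. if k = k\<^sub>0 then ennreal S else 1) * ennreal (2 * B)"
  proof (intro mult_mono prod_mono_ennreal)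
    fix k
    show "weak_norm scale_ell1 1 (x k) \<le> (if k = k\<^sub>0 then ennreal S else 1)"
    proof (cases "k = k\<^sub>0")
      case True
      then show ?thesis
        using weak_norm_sign_average_le[OF b, of c e, where 'k = 'k] by (simp add: x_def y_def S_def)
    next
      case False
      have "weak_norm scale_ell1 1 (x k) \<le> ennreal 1"
      proof (rule weak_norm_one_le[where n = 1])
        fix f :: "'k ell1 \<Rightarrow> 'k" assume "f \<in> dual_ball scale_ell1"
        then show "(\<Sum>i<1. norm (f (x k i))) \<le> 1"
          using dual_ballD(2)[of f scale_ell1 "ell1_unit 0"] False by (simp add: x_def norm_ell1_unit)
      qed (use False in \<open>simp add: x_def\<close>)
      then show ?thesis using False by simp
    qed
    show "weak_norm s 1 w \<le> ennreal (2 * B)"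
      unfolding w_def by (rule weak_norm_signs_le[OF signs z])
  qed auto
  also have "\<dots> = ennreal (C * S * (2 * B))"
    using C S B by (simp add: prod.delta ennreal_mult)
  finally have "S\<^sup>2 \<le> S * (2 * C * B)"
    using C S B by (subst (asm) ennreal_le_iff) (auto simp: mult_ac)
  then have "S \<le> 2 * C * B"
  proof (cases "S = 0")
    case False
    then show ?thesis using \<open>S\<^sup>2 \<le> S * (2 * C * B)\<close> S(1) by (simp add: power2_eq_square)
  qed (use C B in simp)
  then show ?thesis using S power_mono[of S "2 * C * B" 2] by (simp add: c_def)
qed

text \<open>If the Orlicz property fails for every constant, countably many finite families witness
  this. Their norming functionals form one sequence, hence one form, and its single summing constant
  contradicts the failures. The hypotheses \<open>hb\<close> and \<open>signs\<close> collect what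
  differs between the scalar fields.\<close>

theorem cotype_index_eq_2_if_summing:
  fixes s :: "'k::{real_normed_field,banach,real_inner} \<Rightarrow> 'z::real_normed_vector \<Rightarrow> 'z"
  assumes s: "normed_space_over s"
    and hb: "\<And>z. \<exists>f. Vector_Spaces.linear s (*) f \<and> (\<forall>x. norm (f x) \<le> norm x) \<and> norm (f z) = norm z"
    and signs: "\<And>n (a :: nat \<Rightarrow> 'k) B. (\<And>\<delta>. \<delta> \<in> signs n \<Longrightarrow> norm (\<Sum>i<n. \<delta> i *\<^sub>R a i) \<le> B) \<Longrightarrow> (\<Sum>i<n. norm (a i)) \<le> 2 * B"
    and eq: "(multilinear_maps scale_ell1 s (*) :: (('m::finite \<Rightarrow> 'k ell1) \<times> 'z \<Rightarrow> 'k) set)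
        = mult_summing_maps 1 1 scale_ell1 s (*)"
  shows "cotype_index TYPE('z) = 2"
proof (rule ccontr)
  assume contr: "cotype_index TYPE('z) \<noteq> 2"
  have "\<not> orlicz_property TYPE('z) (real (Suc N))" for N
    using cotype_index_eq_2_if_orlicz[where 'z = 'z, of "real (Suc N)"] contr by auto
  moreover define bad where "bad N n z B \<longleftrightarrow> (\<forall>\<delta>\<in>signs n. norm (\<Sum>i<n. \<delta> i *\<^sub>R z i) \<le> B) \<and>
      real (Suc N) * B\<^sup>2 < (\<Sum>i<n. (norm (z i))\<^sup>2)" for N n B and z :: "nat \<Rightarrow> 'z"
  ultimately have "\<exists>n z B. bad N n z B" for N
    unfolding orlicz_property_def by (meson not_le)
  then obtain n z B where "\<And>N. bad N (n N) (z N) (B N)"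
    by metis
  then have z: "\<And>N \<delta>. \<delta> \<in> signs (n N) \<Longrightarrow> norm (\<Sum>i<n N. \<delta> i *\<^sub>R z N i) \<le> B N"
    and big: "\<And>N. real (Suc N) * (B N)\<^sup>2 < (\<Sum>i<n N. (norm (z N i))\<^sup>2)"
    by (simp_all add: bad_def)
  obtain \<phi> where \<phi>: "\<And>v. Vector_Spaces.linear s (*) (\<phi> v)" "\<And>v x. norm (\<phi> v x) \<le> norm x"
    "\<And>v. norm (\<phi> v v) = norm v"
    using hb by metis
  \<comment> \<open>Index \<open>prod_encode (N, j)\<close> carries the functional norming the
    \<open>j\<close>-th vector of the \<open>N\<close>-th family.\<close>
  define \<psi> where "\<psi> p = \<phi> (z (fst (prod_decode p)) (snd (prod_decode p)))" for p
  have \<psi>: "Vector_Spaces.linear s (*) (\<psi> p)" "norm (\<psi> p x) \<le> norm x" for p x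
    by (simp_all add: \<psi>_def \<phi>)
  \<comment> \<open>Types are nonempty, which reflects \<open>m \<ge> 1\<close>: there is a slot for
    the pairing.\<close>
  fix k\<^sub>0 :: 'm
  have "(pairing_map \<psi> k\<^sub>0 :: ('m \<Rightarrow> 'k ell1) \<times> 'z \<Rightarrow> 'k) \<in> mult_summing_maps 1 1 scale_ell1 s (*)"
    unfolding eq[symmetric] by (rule pairing_map_multilinear[OF s \<psi>])
  then obtain C where C: "0 < C" and summing: "\<And>(x :: 'm \<Rightarrow> nat \<Rightarrow> 'k ell1) (z :: nat \<Rightarrow> 'z).
       enn_powr (\<Sum>\<^sub>\<infinity>(i, j)\<in>(UNIV :: (('m \<Rightarrow> nat) \<times> nat) set).
                   ennreal (norm (pairing_map \<psi> k\<^sub>0 (\<lambda>k. x k (i k), z j)) powr 1)) (1 / 1)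
         \<le> ennreal C * (\<Prod>k\<in>UNIV. weak_norm scale_ell1 1 (x k)) * weak_norm s 1 z"
    unfolding mult_summing_maps_def by blast
  have bound: "(\<Sum>j<n N. (norm (z N j))\<^sup>2) \<le> (2 * C * B N)\<^sup>2" for N
    by (rule sum_squares_le_if_summing[OF s \<psi> signs C summing z, where e = "\<lambda>j. prod_encode (N, j)"])
       (simp_all add: \<psi>_def \<phi>)
  obtain N :: nat where "(2 * C)\<^sup>2 \<le> real N" using real_arch_simple by blast
  then have "(2 * C)\<^sup>2 * (B N)\<^sup>2 \<le> real (Suc N) * (B N)\<^sup>2" by (intro mult_right_mono) auto
  then show False using big[of N] bound[of N] by (simp add: power_mult_distrib)
qed

section \<open>Scalar sign inequalities and the two scalar fields\<close>

lemma sum_abs_le_of_signs: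
  fixes a :: "nat \<Rightarrow> real"
  assumes "\<And>\<delta>. \<delta> \<in> signs n \<Longrightarrow> \<bar>\<Sum>i<n. \<delta> i *\<^sub>R a i\<bar> \<le> B"
  shows "(\<Sum>i<n. \<bar>a i\<bar>) \<le> B"
proof -
  define \<delta> where "\<delta> = (\<lambda>i\<in>{..<n}. if 0 \<le> a i then 1 else -1 :: real)"
  have "\<delta> \<in> signs n" unfolding \<delta>_def by (rule restrict_PiE_iff[THEN iffD2]) auto
  moreover have "(\<Sum>i<n. \<delta> i *\<^sub>R a i) = (\<Sum>i<n. \<bar>a i\<bar>)"
    by (rule sum.cong) (auto simp: \<delta>_def)
  ultimately show ?thesis using assms[of \<delta>] by simp
qed

text \<open>Real signs cannot rotate complex terms, so real and imaginary parts are bounded by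
  \<open>B\<close> separately.\<close>

lemma sum_norm_complex_le_of_signs:
  fixes a :: "nat \<Rightarrow> complex"
  assumes B: "\<And>\<delta>. \<delta> \<in> signs n \<Longrightarrow> norm (\<Sum>i<n. \<delta> i *\<^sub>R a i) \<le> B"
  shows "(\<Sum>i<n. norm (a i)) \<le> 2 * B"
proof -
  have "(\<Sum>i<n. \<bar>Re (a i)\<bar>) \<le> B"
  proof (rule sum_abs_le_of_signs)
    fix \<delta> assume \<delta>: "\<delta> \<in> signs n"
    have "(\<Sum>i<n. \<delta> i *\<^sub>R Re (a i)) = Re (\<Sum>i<n. \<delta> i *\<^sub>R a i)" by simp
    then show "\<bar>\<Sum>i<n. \<delta> i *\<^sub>R Re (a i)\<bar> \<le> B"
      using order_trans[OF abs_Re_le_cmod B[OF \<delta>]] by simp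
  qed
  moreover have "(\<Sum>i<n. \<bar>Im (a i)\<bar>) \<le> B"
  proof (rule sum_abs_le_of_signs)
    fix \<delta> assume \<delta>: "\<delta> \<in> signs n"
    have "(\<Sum>i<n. \<delta> i *\<^sub>R Im (a i)) = Im (\<Sum>i<n. \<delta> i *\<^sub>R a i)" by simp
    then show "\<bar>\<Sum>i<n. \<delta> i *\<^sub>R Im (a i)\<bar> \<le> B"
      using order_trans[OF abs_Im_le_cmod B[OF \<delta>]] by simp
  qed
  moreover have "(\<Sum>i<n. norm (a i)) \<le> (\<Sum>i<n. \<bar>Re (a i)\<bar> + \<bar>Im (a i)\<bar>)"
    by (intro sum_mono cmod_le)
  ultimately show ?thesis by (simp add: sum.distrib)
qed

theorem corollary4p5:
  fixes scaleC :: "complex \<Rightarrow> 'z::banach \<Rightarrow> 'z"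
  shows
    "((multilinear_maps scale_ell1 scaleR (*)
          :: (('m::finite \<Rightarrow> real ell1) \<times> 'z \<Rightarrow> real) set)
        = mult_summing_maps 1 1 scale_ell1 scaleR (*)
      \<longrightarrow> cotype_index TYPE('z) = 2)
     \<and>
     (normed_space_over scaleC \<longrightarrow>
      (multilinear_maps scale_ell1 scaleC (*)
          :: (('m \<Rightarrow> complex ell1) \<times> 'z \<Rightarrow> complex) set)
        = mult_summing_maps 1 1 scale_ell1 scaleC (*)
      \<longrightarrow> cotype_index TYPE('z) = 2)"
proof (intro conjI impI)
  assume eq: "(multilinear_maps scale_ell1 scaleR (*)
          :: (('m::finite \<Rightarrow> real ell1) \<times> 'z \<Rightarrow> real) set)
        = mult_summing_maps 1 1 scale_ell1 scaleR (*)"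
  show "cotype_index TYPE('z) = 2"
  proof (rule cotype_index_eq_2_if_summing[OF normed_space_over_scaleR _ _ eq])
    fix z :: 'z
    obtain f where f: "linear f" "\<And>x. \<bar>f x\<bar> \<le> norm x" "f z = norm z"
      using norming_functional[of z] by blast
    have "Vector_Spaces.linear scaleR (*) f"
      using f(1) by (simp add: Real_Vector_Spaces.linear_def real_scaleR_def[abs_def])
    then show "\<exists>f. Vector_Spaces.linear scaleR (*) f \<and> (\<forall>x. norm (f x) \<le> norm x) \<and> norm (f z) = norm z"
      using f by (intro exI[of _ f]) simp
  next
    fix n and a :: "nat \<Rightarrow> real" and B
    assume B: "\<And>\<delta>. \<delta> \<in> signs n \<Longrightarrow> norm (\<Sum>i<n. \<delta> i *\<^sub>R a i) \<le> B"
    have "(\<Sum>i<n. \<bar>a i\<bar>) \<le> B" by (rule sum_abs_le_of_signs) (use B in simp)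
    \<comment> \<open>Nonnegativity of \<open>B\<close> allows the real bound \<open>B\<close> to be
      weakened to \<open>2 * B\<close>.\<close>
    moreover from this have "0 \<le> B" by (rule order_trans[rotated]) (simp add: sum_nonneg)
    ultimately show "(\<Sum>i<n. norm (a i)) \<le> 2 * B" by simp
  qed
next
  assume s: "normed_space_over scaleC" and
    eq: "(multilinear_maps scale_ell1 scaleC (*)
          :: (('m \<Rightarrow> complex ell1) \<times> 'z \<Rightarrow> complex) set)
        = mult_summing_maps 1 1 scale_ell1 scaleC (*)"
  show "cotype_index TYPE('z) = 2"
  proof (rule cotype_index_eq_2_if_summing[OF s _ sum_norm_complex_le_of_signs eq])
    fix z :: 'z
    obtain f where "Vector_Spaces.linear scaleC (*) f" "\<And>x. norm (f x) \<le> norm x" "f z = of_real (norm z)"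
      using norming_functional_complex[OF s, of z] by blast
    then show "\<exists>f. Vector_Spaces.linear scaleC (*) f \<and> (\<forall>x. norm (f x) \<le> norm x) \<and> norm (f z) = norm z"
      by (intro exI[of _ f]) simp
  qed
qed

end
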